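(* Let $G$ be a connected bipartite graph with color classes $E$ and $V$, with a fixed ribbon structure, base node $b_0$ and base edge $b_0b_1$. The violet ordering of the $V$-cut Jaeger trees induces a shelling order of the dissection of the root polytope $Q_G$ formed by the simplices $Q_T$ ($T$ a $V$-cut Jaeger tree). Moreover, for each $V$-cut Jaeger tree $T$, the number of facets of $Q_T$ that lie in the union of the simplices preceding $Q_T$ in this order equals the number of internally semi-passive edges of $T$ with respect to the emerald $T$-order of the edges of $G$.
   Context: Root polytope: in $\mathbb R^E\oplus\mathbb R^V$ with standard basis vectors $\mathbf x$, $Q_G=\mathrm{conv}\{\mathbf e+\mathbf v: ev\in E(G)\}$; for a spanning tree $T$, $Q_T$ is its (maximal-dimensional) simplex. A dissection of $Q_G$ is a set of maximal simplices with union $Q_G$ and pairwise disjoint interiors. A shelling order of a dissection is a total order of its simplices such that each simplex $\sigma$ other than the first meets the union of the preceding ones in a nonempty union of facets of $\sigma$. A ribbon structure assigns to each node $x$ a cyclic permutation of its incident edges; $xy^+$ (resp. $xy^-$) is the edge following (resp. preceding) $xy$ at $x$; the reversed structure inverts all cyclic permutations. Tour of a spanning tree $T$ for a ribbon structure, base node $b_0$, base edge $b_0c$: pairs (current node, current edge) starting with $(b_0,b_0c)$; from $(x,xy)$ go to $(x,xy^+)$ if $xy\notin T$, to $(y,yx^+)$ if $xy\in T$; stop right before $(b_0,b_0c)$ recurs. Each edge $xy$ appears exactly twice; a non-edge $xy$ of $T$ is cut at $x$ if $(x,xy)$ comes first. $T$ is a $V$-cut Jaeger tree if (for the original structure and base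 edge $b_0b_1$) every non-edge is cut at its endpoint in $V$. The violet tour is the tour for the original structure and $b_0b_1$; the emerald tour is the tour for the reversed structure with base edge $b_0b_1^-$ (taken in the original structure). Violet order of $V$-cut Jaeger trees: for distinct $T_1,T_2$, consider the last moment at which their violet tours coincide, when some edge $\varepsilon$ is current and belongs to exactly one of them; $T_1<_VT_2$ iff $\varepsilon\in T_2$. Emerald $T$-order on edges: $ev<_{T,E}e'v'$ ($e,e'\in E$) iff $(e,ev)$ precedes $(e',e'v')$ in the emerald tour. For $\varepsilon\in T$, $C^*(T,\varepsilon)$ is the set of edges of $G$ joining the two components of $T-\varepsilon$. Given a linear order on edges, $\varepsilon\in T$ is internally semi-passive if the smallest edge of $C^*(T,\varepsilon)$ has, in each component of $T-\varepsilon$, an endpoint of color different from the endpoint of $\varepsilon$ in that component. *)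

theory Defs
  imports
    "HOL-Analysis.Analysis"
    "HOL-Combinatorics.Combinatorics"
    "HOL-Library.Sublist"
begin

text \<open>
  A bipartite graph with (finite, nonempty) color classes \<open>E\<close> and \<open>V\<close> is given by a set of edges
  \<open>G :: ('e \<times> 'v) set\<close>, where the types \<open>'e\<close> and \<open>'v\<close> are the two color classes and
  \<open>(e, v) \<in> G\<close> is the edge joining \<open>e \<in> E\<close> to \<open>v \<in> V\<close>. The nodes are the elements of the disjoint
  union \<open>'e + 'v\<close>. Spanning subgraphs (in particular spanning trees) are subsets of \<open>G\<close>.
\<close>

type_synonym ('e, 'v) node = "'e + 'v"
type_synonym ('e, 'v) edge = "'e \<times> 'v"

fun ends :: "('e, 'v) edge \<Rightarrow> ('e, 'v) node set" where
  "ends (e, v) = {Inl e, Inr v}"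

fun other_end :: "('e, 'v) node \<Rightarrow> ('e, 'v) edge \<Rightarrow> ('e, 'v) node" where
  "other_end (Inl _) (e, v) = Inr v"
| "other_end (Inr _) (e, v) = Inl e"

definition incident_edges :: "('e, 'v) edge set \<Rightarrow> ('e, 'v) node \<Rightarrow> ('e, 'v) edge set" where
  "incident_edges G x = {\<epsilon> \<in> G. x \<in> ends \<epsilon>}"

definition adjacent :: "('e, 'v) edge set \<Rightarrow> ('e, 'v) node rel" where
  "adjacent H = {(x, y). \<exists>\<epsilon>\<in>H. x \<noteq> y \<and> ends \<epsilon> = {x, y}}"

definition component :: "('e, 'v) edge set \<Rightarrow> ('e, 'v) node \<Rightarrow> ('e, 'v) node set" where
  "component H x = {y. (x, y) \<in> (adjacent H)\<^sup>*}"

definition connected_graph :: "('e, 'v) edge set \<Rightarrow> bool" where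
  "connected_graph H \<longleftrightarrow> (\<forall>x. component H x = UNIV)"

definition is_cycle :: "('e, 'v) edge set \<Rightarrow> ('e, 'v) node list \<Rightarrow> bool" where
  "is_cycle H xs \<longleftrightarrow> length xs \<ge> 3 \<and> distinct xs \<and>
     (\<forall>i. Suc i < length xs \<longrightarrow> (xs ! i, xs ! Suc i) \<in> adjacent H) \<and>
     (last xs, hd xs) \<in> adjacent H"

definition spanning_tree :: "('e, 'v) edge set \<Rightarrow> ('e, 'v) edge set \<Rightarrow> bool" where
  "spanning_tree G T \<longleftrightarrow> T \<subseteq> G \<and> connected_graph T \<and> (\<nexists>xs. is_cycle T xs)"


text \<open>The value \<open>r x \<epsilon>\<close> of a ribbon structure is the edge following \<open>\<epsilon>\<close> at the node \<open>x\<close>.\<close>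

type_synonym ('e, 'v) ribbon = "('e, 'v) node \<Rightarrow> ('e, 'v) edge \<Rightarrow> ('e, 'v) edge"

definition ribbon_structure :: "('e, 'v) edge set \<Rightarrow> ('e, 'v) ribbon \<Rightarrow> bool" where
  "ribbon_structure G r \<longleftrightarrow>
     (\<forall>x. r x permutes incident_edges G x \<and> cyclic_on (r x) (incident_edges G x))"

definition reversed :: "('e, 'v) ribbon \<Rightarrow> ('e, 'v) ribbon" where
  "reversed r x = inv (r x)"

fun tour_step ::
  "('e, 'v) ribbon \<Rightarrow> ('e, 'v) edge set \<Rightarrow> ('e, 'v) node \<times> ('e, 'v) edge \<Rightarrow> ('e, 'v) node \<times> ('e, 'v) edge"
where
  "tour_step r T (x, \<epsilon>) =
     (if \<epsilon> \<in> T then (other_end x \<epsilon>, r (other_end x \<epsilon>) \<epsilon>) else (x, r x \<epsilon>))"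

definition tour ::
  "('e, 'v) ribbon \<Rightarrow> ('e, 'v) node \<Rightarrow> ('e, 'v) edge \<Rightarrow> ('e, 'v) edge set \<Rightarrow> (('e, 'v) node \<times> ('e, 'v) edge) list"
where
  "tour r b \<beta> T = map (\<lambda>i. (tour_step r T ^^ i) (b, \<beta>))
     [0 ..< (LEAST n. n > 0 \<and> (tour_step r T ^^ n) (b, \<beta>) = (b, \<beta>))]"

definition precedes_in :: "'a list \<Rightarrow> 'a \<Rightarrow> 'a \<Rightarrow> bool" where
  "precedes_in xs a b \<longleftrightarrow> (\<exists>i j. i < j \<and> j < length xs \<and> xs ! i = a \<and> xs ! j = b)"

abbreviation violet_tour where
  "violet_tour r b0 \<beta> T \<equiv> tour r b0 \<beta> T"

abbreviation emerald_tour where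
  "emerald_tour r b0 \<beta> T \<equiv> tour (reversed r) b0 (inv (r b0) \<beta>) T"

definition V_cut_Jaeger_trees ::
  "('e, 'v) edge set \<Rightarrow> ('e, 'v) ribbon \<Rightarrow> ('e, 'v) node \<Rightarrow> ('e, 'v) edge \<Rightarrow> ('e, 'v) edge set set"
where
  "V_cut_Jaeger_trees G r b0 \<beta> = {T. spanning_tree G T \<and>
     (\<forall>(e, v) \<in> G - T. precedes_in (violet_tour r b0 \<beta> T) (Inr v, (e, v)) (Inl e, (e, v)))}"

text \<open>The last moment at which two tours coincide is the end of their longest common initial segment.\<close>

definition violet_less ::
  "('e, 'v) ribbon \<Rightarrow> ('e, 'v) node \<Rightarrow> ('e, 'v) edge \<Rightarrow> ('e, 'v) edge set \<Rightarrow> ('e, 'v) edge set \<Rightarrow> bool"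
where
  "violet_less r b0 \<beta> T1 T2 \<longleftrightarrow> T1 \<noteq> T2 \<and>
     snd (last (longest_common_prefix (violet_tour r b0 \<beta> T1) (violet_tour r b0 \<beta> T2))) \<in> T2"

definition emerald_less ::
  "('e, 'v) ribbon \<Rightarrow> ('e, 'v) node \<Rightarrow> ('e, 'v) edge \<Rightarrow> ('e, 'v) edge set \<Rightarrow> ('e, 'v) edge \<Rightarrow> ('e, 'v) edge \<Rightarrow> bool"
where
  "emerald_less r b0 \<beta> T \<epsilon> \<epsilon>' \<longleftrightarrow>
     precedes_in (emerald_tour r b0 \<beta> T) (Inl (fst \<epsilon>), \<epsilon>) (Inl (fst \<epsilon>'), \<epsilon>')"

definition fundamental_cut ::
  "('e, 'v) edge set \<Rightarrow> ('e, 'v) edge set \<Rightarrow> ('e, 'v) edge \<Rightarrow> ('e, 'v) edge set"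
where
  "fundamental_cut G T \<epsilon> = {f \<in> G. \<exists>x y. ends \<epsilon> = {x, y} \<and>
     ends f \<inter> component (T - {\<epsilon>}) x \<noteq> {} \<and> ends f \<inter> component (T - {\<epsilon>}) y \<noteq> {} \<and> x \<noteq> y}"

text \<open>
  In \<open>T - \<epsilon>\<close> the component containing the endpoint of \<open>\<epsilon>\<close> in \<open>E\<close> must contain the endpoint of
  the smallest edge \<open>f\<close> in \<open>V\<close>, and vice versa.
\<close>

definition internally_semi_passive ::
  "('e, 'v) edge set \<Rightarrow> (('e, 'v) edge \<Rightarrow> ('e, 'v) edge \<Rightarrow> bool) \<Rightarrow> ('e, 'v) edge set \<Rightarrow> ('e, 'v) edge \<Rightarrow> bool"
where
  "internally_semi_passive G lt T \<epsilon> \<longleftrightarrow> \<epsilon> \<in> T \<and>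
     (\<exists>f \<in> fundamental_cut G T \<epsilon>.
        (\<forall>f' \<in> fundamental_cut G T \<epsilon>. f' \<noteq> f \<longrightarrow> lt f f') \<and>
        Inr (snd f) \<in> component (T - {\<epsilon>}) (Inl (fst \<epsilon>)) \<and>
        Inl (fst f) \<in> component (T - {\<epsilon>}) (Inr (snd \<epsilon>)))"


fun node_vector :: "('e::finite, 'v::finite) node \<Rightarrow> (real ^ 'e) \<times> (real ^ 'v)" where
  "node_vector (Inl e) = (axis e 1, 0)"
| "node_vector (Inr v) = (0, axis v 1)"

text \<open>For a spanning tree \<open>T\<close>, \<open>root_polytope T\<close> is the simplex \<open>Q\<^sub>T\<close>.\<close>

definition root_polytope :: "('e::finite, 'v::finite) edge set \<Rightarrow> ((real ^ 'e) \<times> (real ^ 'v)) set" where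
  "root_polytope G = convex hull {node_vector (Inl e) + node_vector (Inr v) |e v. (e, v) \<in> G}"

text \<open>
  The polytope \<open>P\<close> need not be full-dimensional in the ambient space (the root polytope never is), so
  interiors are relative interiors.
\<close>

definition dissection :: "'a::euclidean_space set \<Rightarrow> 'a set set \<Rightarrow> bool" where
  "dissection P D \<longleftrightarrow> finite D \<and> (\<forall>\<sigma>\<in>D. (aff_dim P) simplex \<sigma>) \<and> \<Union>D = P \<and>
     pairwise (\<lambda>\<sigma> \<tau>. rel_interior \<sigma> \<inter> rel_interior \<tau> = {}) D"

text \<open>The relation \<open>R\<close> is the strict total order; \<open>(\<tau>, \<sigma>) \<in> R\<close> means that \<open>\<tau>\<close> precedes \<open>\<sigma>\<close>.\<close>

definition shelling_order :: "'a::euclidean_space set \<Rightarrow> 'a set set \<Rightarrow> 'a set rel \<Rightarrow> bool" where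
  "shelling_order P D R \<longleftrightarrow> dissection P D \<and> R \<subseteq> D \<times> D \<and> strict_linear_order_on D R \<and>
     (\<forall>\<sigma>\<in>D. (\<exists>\<tau>. (\<tau>, \<sigma>) \<in> R) \<longrightarrow>
        (\<exists>\<F>. \<F> \<noteq> {} \<and> (\<forall>F\<in>\<F>. F facet_of \<sigma>) \<and> \<sigma> \<inter> \<Union>{\<tau>. (\<tau>, \<sigma>) \<in> R} = \<Union>\<F>))"

end

theory Submission
  imports Defs
begin

text \<open>
  For a spanning tree \<open>T\<close> and \<open>\<epsilon> = (e, v) \<in> T\<close> let \<open>A\<close> be the component of \<open>T - \<epsilon>\<close> containing \<open>e\<close>. The linear
  functional \<open>p \<mapsto> p(E \<inter> A) - p(V \<inter> A)\<close> reads off the coefficient of \<open>\<epsilon>\<close> in \<open>Q\<^sub>T\<close>; on an edge of \<open>G\<close> it is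
  \<open>1\<close>, \<open>-1\<close> or \<open>0\<close>, according to whether the edge crosses the cut in the same direction as \<open>\<epsilon>\<close>, in the
  opposite direction, or not at all. If \<open>b\<^sub>0 \<notin> A\<close>, the tour stays in \<open>A\<close> exactly
  between the two occurrences of \<open>\<epsilon>\<close>. Therefore, if a Jaeger tree \<open>T'\<close> precedes \<open>T\<close> and \<open>\<epsilon>\<close> is the edge where the tours
  separate, then \<open>T\<close> has cut all other edges of the same direction before \<open>\<epsilon>\<close>, so that \<open>T'\<close> contains none
  of them and the functional separates \<open>Q\<^sub>T\<close> from \<open>Q\<^bsub>T'\<^esub>\<close>. As the emerald tour is the violet tour run
  backwards, such an \<open>\<epsilon>\<close> is semi-passive; indeed \<open>\<epsilon>\<close> is semi-passive iff \<open>b\<^sub>0 \<notin> A\<close> and some edge of the cut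
  has the opposite direction. That the simplices cover \<open>Q\<^sub>G\<close> follows by choosing, for a point of \<open>Q\<^sub>G\<close>, the
  spanning tree \<open>T\<close> with the point in \<open>Q\<^sub>T\<close> that prefers traversing edges at nodes in \<open>E\<close> and skipping them
  at nodes in \<open>V\<close>: if an edge of \<open>G - T\<close> were cut in \<open>E\<close>, an exchange step would give a better tree.
\<close>

section \<open>Connectivity and bridges\<close>

lemma adjacent_iff [simp]:
  "(Inl e, Inr v) \<in> adjacent H \<longleftrightarrow> (e, v) \<in> H"
  "(Inr v, Inl e) \<in> adjacent H \<longleftrightarrow> (e, v) \<in> H"
  "(Inl e, Inl e') \<notin> adjacent H"
  "(Inr v, Inr v') \<notin> adjacent H"
  by (force simp: adjacent_def doubleton_eq_iff)+

lemma adjacent_sym: "(x, y) \<in> adjacent H \<Longrightarrow> (y, x) \<in> adjacent H"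
  by (cases x; cases y) auto

lemma adjacent_ends: "(x, y) \<in> adjacent H \<Longrightarrow> \<exists>e v. (e, v) \<in> H \<and> {x, y} = {Inl e, Inr v}"
  by (cases x; cases y) (auto simp: doubleton_eq_iff)

lemma adjacent_mono: "H \<subseteq> K \<Longrightarrow> adjacent H \<subseteq> adjacent K"
  unfolding adjacent_def by blast

lemma component_refl [simp]: "x \<in> component H x"
  by (simp add: component_def)

lemma component_sym: "y \<in> component H x \<Longrightarrow> x \<in> component H y"
  unfolding component_def mem_Collect_eq
  by (rule symD[OF sym_rtrancl]) (auto intro: symI adjacent_sym)

lemma component_trans: "y \<in> component H x \<Longrightarrow> z \<in> component H y \<Longrightarrow> z \<in> component H x"
  unfolding component_def by auto

lemma component_mono: "H \<subseteq> K \<Longrightarrow> component H x \<subseteq> component K x"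
  unfolding component_def using rtrancl_mono[OF adjacent_mono] by blast

lemma component_step: "y \<in> component H x \<Longrightarrow> (y, z) \<in> adjacent H \<Longrightarrow> z \<in> component H x"
  unfolding component_def by (auto intro: rtrancl_into_rtrancl)

lemma component_edge: "(e, v) \<in> H \<Longrightarrow> Inl e \<in> component H x \<longleftrightarrow> Inr v \<in> component H x"
  by (meson adjacent_iff component_step)

lemma component_subsetI:
  assumes "x \<in> S" and "\<And>y z. y \<in> S \<Longrightarrow> (y, z) \<in> adjacent H \<Longrightarrow> z \<in> S"
  shows "component H x \<subseteq> S"
proof
  fix y assume "y \<in> component H x"
  then have "(x, y) \<in> (adjacent H)\<^sup>*" by (simp add: component_def)
  then show "y \<in> S" by induction (use assms in auto)
qed

lemma component_empty: "component {} x = {x}"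
  using component_subsetI[of x "{x}" "{}"] by (auto simp: adjacent_def)

lemma component_eq: "y \<in> component H x \<Longrightarrow> component H y = component H x"
  by (blast intro: component_trans component_sym)

lemma component_insert:
  "component (insert (e, v) H) x \<subseteq> component H x \<union> component H (Inl e) \<union> component H (Inr v)"
proof (rule component_subsetI)
  fix y z assume y: "y \<in> component H x \<union> component H (Inl e) \<union> component H (Inr v)"
    and "(y, z) \<in> adjacent (insert (e, v) H)"
  then consider "(y, z) \<in> adjacent H" | "z \<in> {Inl e, Inr v}"
    by (cases y; cases z) auto
  then show "z \<in> component H x \<union> component H (Inl e) \<union> component H (Inr v)"
    using y component_step by cases auto
qed simp

section \<open>Forests as graphs in which every edge is a bridge\<close>

definition forest :: "('e, 'v) edge set \<Rightarrow> bool" where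
  "forest H \<longleftrightarrow> (\<forall>(e, v)\<in>H. Inr v \<notin> component (H - {(e, v)}) (Inl e))"

lemma forest_subset: "forest H \<Longrightarrow> K \<subseteq> H \<Longrightarrow> forest K"
  unfolding forest_def using component_mono[of "K - {x}" "H - {x}" for x] by blast

lemma successively_component:
  "successively (\<lambda>x y. (x, y) \<in> adjacent H) xs \<Longrightarrow> xs \<noteq> [] \<Longrightarrow> last xs \<in> component H (hd xs)"
proof (induction xs rule: induct_list012)
  case (3 x y zs)
  then have "last (y # zs) \<in> component H y" "y \<in> component H x"
    by (auto intro: component_step[OF component_refl])
  then show ?case by (auto intro: component_trans)
qed auto

lemma component_path:
  assumes "y \<in> component H x"
  shows "\<exists>xs. xs \<noteq> [] \<and> hd xs = x \<and> last xs = y \<and> distinct xs \<and>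
    successively (\<lambda>x y. (x, y) \<in> adjacent H) xs"
proof -
  have "(x, y) \<in> (adjacent H)\<^sup>*" using assms by (simp add: component_def)
  then show ?thesis
  proof induction
    case base
    show ?case by (rule exI[of _ "[x]"]) auto
  next
    case (step y z)
    then obtain xs where xs: "xs \<noteq> []" "hd xs = x" "last xs = y" "distinct xs"
      "successively (\<lambda>x y. (x, y) \<in> adjacent H) xs" by auto
    show ?case
    proof (cases "z \<in> set xs")
      case True
      then obtain ys zs where split: "xs = ys @ z # zs" by (auto simp: in_set_conv_decomp)
      then have "successively (\<lambda>x y. (x, y) \<in> adjacent H) ((ys @ [z]) @ zs)" using xs by simp
      then have "successively (\<lambda>x y. (x, y) \<in> adjacent H) (ys @ [z])"
        unfolding successively_append_iff[of _ "ys @ [z]"] by simp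
      then show ?thesis using xs split
        by (intro exI[of _ "ys @ [z]"]) (auto simp: hd_append split: if_splits)
    next
      case False
      then show ?thesis using xs step.hyps(2)
        by (intro exI[of _ "xs @ [z]"]) (auto simp: successively_append_iff hd_append)
    qed
  qed
qed

lemma is_cycle_successively:
  "is_cycle H xs \<longleftrightarrow> length xs \<ge> 3 \<and> distinct xs \<and>
     successively (\<lambda>x y. (x, y) \<in> adjacent H) xs \<and> (last xs, hd xs) \<in> adjacent H"
  unfolding is_cycle_def successively_conv_nth by auto

lemma adjacent_Diff:
  "(x, y) \<in> adjacent H \<Longrightarrow> {x, y} \<noteq> {Inl e, Inr v} \<Longrightarrow> (x, y) \<in> adjacent (H - {(e, v)})"
  by (cases x; cases y) auto

text \<open>The ends sit at the indices \<open>0\<close> and \<open>length xs - 1\<close>, which are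
  not consecutive once there are three nodes. So no step of the path uses the edge joining its
  ends.\<close>

lemma successively_avoid_edge:
  assumes "successively (\<lambda>x y. (x, y) \<in> adjacent H) xs" "distinct xs" "length xs \<ge> 3"
    "{last xs, hd xs} = {Inl e, Inr v}"
  shows "successively (\<lambda>x y. (x, y) \<in> adjacent (H - {(e, v)})) xs"
  unfolding successively_conv_nth
proof (intro allI impI)
  fix i assume i: "Suc i < length xs"
  have ne: "{xs ! i, xs ! Suc i} \<noteq> {xs ! (length xs - 1), xs ! 0}"
  proof
    assume "{xs ! i, xs ! Suc i} = {xs ! (length xs - 1), xs ! 0}"
    moreover have "i < length xs" "0 < length xs" "length xs - 1 < length xs" using i by auto
    ultimately have "i = length xs - 1 \<or> i = 0 \<and> Suc i = length xs - 1"
      unfolding doubleton_eq_iff using i nth_eq_iff_index_eq[OF assms(2)] by metis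
    then show False using assms(3) i by auto
  qed
  have "{last xs, hd xs} = {xs ! (length xs - 1), xs ! 0}"
    using assms(3) last_conv_nth[of xs] hd_conv_nth[of xs] by fastforce
  then show "(xs ! i, xs ! Suc i) \<in> adjacent (H - {(e, v)})"
    using assms(1,4) i ne by (intro adjacent_Diff) (auto simp: successively_conv_nth)
qed

text \<open>Deleting the closing edge of a cycle leaves a path between its ends, so this edge is no
  bridge. Conversely, an edge closes a simple path that joins its ends without using it. Cuts and
  their functionals need the bridge form.\<close>

lemma forest_iff_no_cycle: "forest H \<longleftrightarrow> (\<nexists>xs. is_cycle H xs)"
proof
  assume f: "forest H"
  show "\<nexists>xs. is_cycle H xs"
  proof
    assume "\<exists>xs. is_cycle H xs"
    then obtain xs where xs: "is_cycle H xs" by blast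
    then obtain e v where ev: "{last xs, hd xs} = {Inl e, Inr v}" "(e, v) \<in> H"
      unfolding is_cycle_successively using adjacent_ends by metis
    then have "successively (\<lambda>x y. (x, y) \<in> adjacent (H - {(e, v)})) xs"
      using xs unfolding is_cycle_successively by (intro successively_avoid_edge) auto
    moreover have "xs \<noteq> []" using xs by (auto simp: is_cycle_def)
    ultimately have "last xs \<in> component (H - {(e, v)}) (hd xs)"
      by (intro successively_component) auto
    then have "Inr v \<in> component (H - {(e, v)}) (Inl e)"
      using ev by (auto simp: doubleton_eq_iff intro: component_sym)
    then show False using f ev by (auto simp: forest_def)
  qed
next
  assume nc: "\<nexists>xs. is_cycle H xs"
  show "forest H"
    unfolding forest_def
  proof safe
    fix e v assume ev: "(e, v) \<in> H" "Inr v \<in> component (H - {(e, v)}) (Inl e)"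
    then obtain xs where xs: "xs \<noteq> []" "hd xs = Inl e" "last xs = Inr v" "distinct xs"
      "successively (\<lambda>x y. (x, y) \<in> adjacent (H - {(e, v)})) xs"
      using component_path[OF ev(2)] by blast
    \<comment> \<open>Shorter paths are excluded: the ends have different colors, and the edge
      between them has been deleted.\<close>
    have "length xs \<ge> 3"
    proof (rule ccontr)
      assume "\<not> length xs \<ge> 3"
      then consider x where "xs = [x]" | x y where "xs = [x, y]"
        using xs(1) by (cases xs; cases "tl xs"; cases "tl (tl xs)") auto
      then show False using xs by cases auto
    qed
    moreover have "successively (\<lambda>x y. (x, y) \<in> adjacent H) xs"
      using xs(5) by (rule successively_mono) (use adjacent_mono[of "H - {(e, v)}" H] in auto)
    ultimately have "is_cycle H xs"
      unfolding is_cycle_successively using xs ev by auto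
    then show False using nc by blast
  qed
qed

lemma spanning_tree_iff: "spanning_tree G T \<longleftrightarrow> T \<subseteq> G \<and> connected_graph T \<and> forest T"
  by (simp add: spanning_tree_def forest_iff_no_cycle)

section \<open>Shores and fundamental cuts\<close>

definition shore :: "('e, 'v) edge set \<Rightarrow> ('e, 'v) edge \<Rightarrow> ('e, 'v) node set" where
  "shore T \<epsilon> = component (T - {\<epsilon>}) (Inl (fst \<epsilon>))"

lemma Inl_shore [simp]: "Inl e \<in> shore T (e, v)"
  by (simp add: shore_def)

lemma Inr_shore: "forest T \<Longrightarrow> (e, v) \<in> T \<Longrightarrow> Inr v \<notin> shore T (e, v)"
  by (auto simp: forest_def shore_def)

lemma shore_edge: "(e', v') \<in> T \<Longrightarrow> (e', v') \<noteq> \<epsilon> \<Longrightarrow> Inl e' \<in> shore T \<epsilon> \<longleftrightarrow> Inr v' \<in> shore T \<epsilon>"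
  by (auto simp: shore_def component_edge)

text \<open>Putting one edge back merges at most two components, so without it a tree consists of
  the components of its two ends.\<close>

lemma shore_compl:
  assumes "connected_graph T" "forest T" "(e, v) \<in> T"
  shows "component (T - {(e, v)}) (Inr v) = - shore T (e, v)"
proof -
  let ?H = "T - {(e, v)}"
  have "insert (e, v) ?H = T" using assms(3) by auto
  then have "UNIV \<subseteq> component ?H (Inl e) \<union> component ?H (Inr v)"
    using component_insert[of e v ?H "Inl e"] assms(1) by (auto simp: connected_graph_def)
  moreover have "z \<notin> component ?H (Inr v)" if "z \<in> component ?H (Inl e)" for z
    using component_trans[OF that component_sym[of z ?H "Inr v"]] Inr_shore[OF assms(2,3)]
    by (auto simp: shore_def)
  ultimately show ?thesis by (auto simp: shore_def)
qed

text \<open>The two components are complementary, so meeting both means having exactly one end in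
  the shore. The shore being the side of the end of \<epsilon> in E, an edge crosses in the
  direction of \<epsilon> iff its end in E is the inner one.\<close>

lemma fundamental_cut_iff:
  assumes "connected_graph T" "forest T" "\<epsilon> \<in> T"
  shows "(e', v') \<in> fundamental_cut G T \<epsilon> \<longleftrightarrow>
    (e', v') \<in> G \<and> (Inl e' \<in> shore T \<epsilon>) \<noteq> (Inr v' \<in> shore T \<epsilon>)"
proof -
  obtain e v where [simp]: "\<epsilon> = (e, v)" by (cases \<epsilon>)
  have c: "component (T - {(e, v)}) (Inl e) = shore T (e, v)" by (simp add: shore_def)
  have "(e', v') \<in> fundamental_cut G T \<epsilon> \<longleftrightarrow> (e', v') \<in> G \<and>
    ends (e', v') \<inter> component (T - {(e, v)}) (Inl e) \<noteq> {} \<and>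
    ends (e', v') \<inter> component (T - {(e, v)}) (Inr v) \<noteq> {}"
    unfolding fundamental_cut_def by (auto simp: doubleton_eq_iff)
  also have "\<dots> \<longleftrightarrow> (e', v') \<in> G \<and> ends (e', v') \<inter> shore T (e, v) \<noteq> {} \<and>
      ends (e', v') \<inter> - shore T (e, v) \<noteq> {}"
    using shore_compl[OF assms(1,2), of e v] assms(3) by (simp only: c \<open>\<epsilon> = (e, v)\<close>)
  also have "\<dots> \<longleftrightarrow> (e', v') \<in> G \<and> (Inl e' \<in> shore T \<epsilon>) \<noteq> (Inr v' \<in> shore T \<epsilon>)"
    by auto
  finally show ?thesis .
qed

lemma connected_graph_iff: "connected_graph H \<longleftrightarrow> (\<forall>y. y \<in> component H x)"
proof
  assume *: "\<forall>y. y \<in> component H x"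
  then have "component H x = UNIV" by auto
  moreover have "component H y = component H x" for y
    using * by (intro component_eq) simp
  ultimately show "connected_graph H" by (simp add: connected_graph_def)
qed (simp add: connected_graph_def)

lemma connected_graph_remove:
  assumes "connected_graph H" "Inr v \<in> component (H - {(e, v)}) (Inl e)"
  shows "connected_graph (H - {(e, v)})"
proof -
  have "component H (Inl e) \<subseteq> component (insert (e, v) (H - {(e, v)})) (Inl e)"
    by (rule component_mono) auto
  also have "\<dots> \<subseteq> component (H - {(e, v)}) (Inl e)"
    using component_insert[of e v "H - {(e, v)}" "Inl e"] component_eq[OF assms(2)] by auto
  finally show ?thesis
    using assms(1) unfolding connected_graph_iff[of _ "Inl e"] by blast
qed

lemma connected_graph_exchange:
  assumes "connected_graph T" "forest T" "\<epsilon> \<in> T"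
    and "(Inl e' \<in> shore T \<epsilon>) \<noteq> (Inr v' \<in> shore T \<epsilon>)"
  shows "connected_graph (insert (e', v') (T - {\<epsilon>}))" (is "connected_graph ?K")
proof -
  obtain e v where [simp]: "\<epsilon> = (e, v)" by (cases \<epsilon>)
  have sub: "component (T - {\<epsilon>}) x \<subseteq> component ?K x" for x
    by (rule component_mono) auto
  have A: "shore T \<epsilon> \<subseteq> component ?K (Inl e)"
    using sub[of "Inl e"] by (simp add: shore_def)
  have B: "- shore T \<epsilon> \<subseteq> component ?K (Inr v)"
    using sub[of "Inr v"] shore_compl[OF assms(1,2), of e v] assms(3) by simp
  have e'v': "Inl e' \<in> component ?K x \<longleftrightarrow> Inr v' \<in> component ?K x" for x
    by (rule component_edge) simp
  then have "Inr v \<in> component ?K (Inl e)"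
  proof (cases "Inl e' \<in> shore T \<epsilon>")
    case True
    then have "Inr v' \<in> component ?K (Inl e)" "Inr v' \<in> component ?K (Inr v)"
      using A B assms(4) e'v' by auto
    then show ?thesis by (blast intro: component_sym component_trans)
  next
    case False
    then have "Inr v' \<in> component ?K (Inl e)" "Inr v' \<in> component ?K (Inr v)"
      using A B assms(4) e'v' by auto
    then show ?thesis by (blast intro: component_sym component_trans)
  qed
  then have "component ?K (Inr v) = component ?K (Inl e)" by (rule component_eq)
  then show ?thesis using A B unfolding connected_graph_iff[of _ "Inl e"] by auto
qed

section \<open>Tours\<close>

text \<open>Pigeonhole gives two equal iterates, and injectivity cancels the earlier one.
  Injectivity is asked only on \<open>S\<close> because the tour step is controlled only on
  flags.\<close>

lemma orbit_self:
  assumes "finite S" "inj_on f S" "f ` S \<subseteq> S" "x \<in> S"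
  shows "x \<in> orbit f x"
proof -
  have S: "(f ^^ n) x \<in> S" for n using assms by (induction n) auto
  have "finite (range (\<lambda>n. (f ^^ n) x))"
    by (rule finite_subset[OF _ assms(1)]) (use S in auto)
  then have "\<not> inj (\<lambda>n. (f ^^ n) x)" by (auto dest: finite_imageD)
  then obtain a b where ab: "a \<noteq> b" "(f ^^ a) x = (f ^^ b) x" unfolding inj_def by blast
  define i where "i = min a b"
  define j where "j = max a b"
  have ij: "i < j" "(f ^^ i) x = (f ^^ j) x" using ab by (auto simp: i_def j_def min_def max_def)
  have funpow_S: "(f ^^ n) ` S \<subseteq> S" for n using assms(3) by (induction n) auto
  have inj: "inj_on (f ^^ n) S" for n
  proof (induction n)
    case (Suc n)
    then show ?case
      using comp_inj_on[OF Suc inj_on_subset[OF assms(2) funpow_S]] by (simp add: o_def)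
  qed simp
  have "(f ^^ i) x = (f ^^ i) ((f ^^ (j - i)) x)"
    using ij funpow_add[of i "j - i" f] by simp
  then have "(f ^^ (j - i)) x = x"
    using inj_onD[OF inj[of i], of x "(f ^^ (j - i)) x"] assms(4) S by simp
  then show ?thesis using ij(1) unfolding orbit_altdef by (auto intro!: exI[of _ "j - i"])
qed

text \<open>From \<open>b\<close> the map \<open>q\<close> enters the orbit at \<open>f a\<close>
  and then follows \<open>f\<close>. Only at \<open>a\<close> may it deviate, and the next point
  there is \<open>f a\<close>, already reached.\<close>

lemma orbit_merge_subset:
  assumes "q b = f a" and "\<And>z. z \<in> orbit f a \<Longrightarrow> z \<noteq> a \<Longrightarrow> q z = f z"
  shows "orbit f a \<subseteq> orbit q b"
proof
  fix z assume "z \<in> orbit f a"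
  then show "z \<in> orbit q b"
  proof induction
    case base
    then show ?case using orbit.base[of q b] assms(1) by simp
  next
    case (step y)
    show ?case
    proof (cases "y = a")
      case True
      then show ?thesis using orbit.base[of q b] assms(1) by simp
    next
      case False
      then have "q y = f y" using assms(2) step.hyps by simp
      then show ?thesis using orbit.step[OF step.IH] by simp
    qed
  qed
qed

text \<open>Adding an edge to a forest composes the tour step with a transposition of flags of different orbits.\<close>

lemma orbit_merge:
  assumes "q b = f a" "q a = f b" and "\<And>z. z \<noteq> a \<Longrightarrow> z \<noteq> b \<Longrightarrow> q z = f z"
    and "a \<in> orbit f a" "b \<in> orbit f b" "b \<notin> orbit f a"
    and "x \<in> orbit f a \<union> orbit f b" "y \<in> orbit f a \<union> orbit f b"
  shows "y \<in> orbit q x"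
proof -
  have nab: "a \<notin> orbit f b" using orbit_swap[OF assms(5)] assms(6) by blast
  have 1: "orbit f b \<subseteq> orbit q a"
  proof (rule orbit_merge_subset)
    fix z assume "z \<in> orbit f b" "z \<noteq> b"
    then show "q z = f z" using nab assms(3)[of z] by blast
  qed (rule assms(2))
  have 2: "orbit f a \<subseteq> orbit q b"
  proof (rule orbit_merge_subset)
    fix z assume "z \<in> orbit f a" "z \<noteq> a"
    then show "q z = f z" using assms(6) assms(3)[of z] by blast
  qed (rule assms(1))
  have "orbit q a \<subseteq> orbit q b"
    using 2 assms(4) orbit_trans[of _ q a b] by auto
  then have b: "z \<in> orbit q b" if "z \<in> orbit f a \<union> orbit f b" for z using 1 2 that by blast
  have "b \<in> orbit q x"
    using orbit_swap[OF b b] assms(5,7) by blast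
  then show ?thesis using orbit_trans[OF b[OF assms(8)]] by blast
qed

lemma orbit_enumeration:
  assumes "orbit f s = S" "s \<in> S" "finite S"
  shows "(LEAST n. n > 0 \<and> (f ^^ n) s = s) = card S"
    and "bij_betw (\<lambda>i. (f ^^ i) s) {..<card S} S"
    and "(f ^^ card S) s = s"
proof -
  define n where "n = (LEAST n. n > 0 \<and> (f ^^ n) s = s)"
  have "\<exists>n. n > 0 \<and> (f ^^ n) s = s" using assms(1,2) unfolding orbit_altdef by force
  then have n: "n > 0" "(f ^^ n) s = s" unfolding n_def by (rule LeastI2_ex; simp)+
  have least: "(f ^^ m) s \<noteq> s" if "0 < m" "m < n" for m
    using not_less_Least[of m] that unfolding n_def by blast
  have inj: "inj_on (\<lambda>i. (f ^^ i) s) {..<n}"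
  proof (rule linorder_inj_onI')
    fix i j assume ij: "i \<in> {..<n}" "j \<in> {..<n}" "i < j"
    show "(f ^^ i) s \<noteq> (f ^^ j) s"
    proof
      assume eq: "(f ^^ i) s = (f ^^ j) s"
      \<comment> \<open>A repetition at times \<open>i < j\<close> can be continued by the remaining
        \<open>n - j\<close> steps to a return after fewer than \<open>n\<close> steps.\<close>
      have "(f ^^ (n - j + i)) s = (f ^^ (n - j)) ((f ^^ i) s)" by (simp add: funpow_add)
      also have "\<dots> = (f ^^ (n - j + j)) s" unfolding eq by (simp add: funpow_add)
      also have "\<dots> = s" using n ij by simp
      finally have "(f ^^ (n - j + i)) s = s" .
      moreover have "(f ^^ (n - j + i)) s \<noteq> s" by (rule least) (use ij in auto)
      ultimately show False by (rule notE[rotated])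
    qed
  qed
  have "S = (\<lambda>i. (f ^^ i) s) ` {..<n}"
    using orbit_altdef_bounded[OF n(2,1)] assms(1) by auto
  then have bij: "bij_betw (\<lambda>i. (f ^^ i) s) {..<n} S"
    using inj by (simp add: bij_betw_def)
  then have card: "card S = n" using bij_betw_same_card[OF bij] by simp
  show "(LEAST n. n > 0 \<and> (f ^^ n) s = s) = card S" using card n_def by simp
  show "bij_betw (\<lambda>i. (f ^^ i) s) {..<card S} S" using bij card by simp
  show "(f ^^ card S) s = s" using n card by simp
qed

lemma finite_ends: "finite (ends \<epsilon>)"
  by (cases \<epsilon>) simp

section \<open>Flags and the tour step\<close>

definition flags :: "('e, 'v) edge set \<Rightarrow> (('e, 'v) node \<times> ('e, 'v) edge) set" where
  "flags G = {(x, \<epsilon>). \<epsilon> \<in> incident_edges G x}"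

lemma flags_iff: "(x, \<epsilon>) \<in> flags G \<longleftrightarrow> \<epsilon> \<in> G \<and> x \<in> ends \<epsilon>"
  by (simp add: flags_def incident_edges_def)

lemma flags_simps [simp]:
  "(Inl e, (e', v)) \<in> flags G \<longleftrightarrow> (e', v) \<in> G \<and> e = e'"
  "(Inr v, (e, v')) \<in> flags G \<longleftrightarrow> (e, v') \<in> G \<and> v = v'"
  by (auto simp: flags_iff)

lemma other_end:
  assumes "x \<in> ends \<epsilon>"
  shows "other_end x \<epsilon> \<in> ends \<epsilon>" "other_end (other_end x \<epsilon>) \<epsilon> = x" "other_end x \<epsilon> \<noteq> x"
    "\<epsilon> \<in> H \<Longrightarrow> (x, other_end x \<epsilon>) \<in> adjacent H"
  using assms by (cases \<epsilon>; auto)+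

text \<open>Factoring the tour step into this involution and a rotation makes its injectivity and
  its time reversal visible.\<close>

fun flip :: "('e, 'v) edge set \<Rightarrow> ('e, 'v) node \<times> ('e, 'v) edge \<Rightarrow> ('e, 'v) node \<times> ('e, 'v) edge" where
  "flip T (x, \<epsilon>) = (if \<epsilon> \<in> T then other_end x \<epsilon> else x, \<epsilon>)"

fun rotate_flag :: "('e, 'v) ribbon \<Rightarrow> ('e, 'v) node \<times> ('e, 'v) edge \<Rightarrow> ('e, 'v) node \<times> ('e, 'v) edge" where
  "rotate_flag r (x, \<epsilon>) = (x, r x \<epsilon>)"

lemma tour_step_eq: "tour_step r T f = rotate_flag r (flip T f)"
  by (cases f) simp

lemma flip_flags: "f \<in> flags G \<Longrightarrow> flip T f \<in> flags G"
  by (cases f) (auto simp: flags_iff other_end)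

lemma flip_flip: "f \<in> flags G \<Longrightarrow> flip T (flip T f) = f"
  by (cases f) (auto simp: flags_iff other_end)

lemma rotate_flags: "ribbon_structure G r \<Longrightarrow> f \<in> flags G \<Longrightarrow> rotate_flag r f \<in> flags G"
  by (cases f) (auto simp: flags_def ribbon_structure_def permutes_in_image)

lemma inj_rotate_flag: "ribbon_structure G r \<Longrightarrow> inj (rotate_flag r)"
proof (rule injI)
  fix f g assume *: "ribbon_structure G r" "rotate_flag r f = rotate_flag r g"
  then have "fst f = fst g" "r (fst f) (snd f) = r (fst f) (snd g)" by (cases f; cases g; simp)+
  moreover have "inj (r (fst f))" using *(1) by (auto simp: ribbon_structure_def intro: permutes_inj)
  ultimately show "f = g" using injD[of "r (fst f)" "snd f" "snd g"] by (simp add: prod_eq_iff)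
qed

lemma reversed_rotate_flag:
  "ribbon_structure G r \<Longrightarrow> rotate_flag (reversed r) (rotate_flag r f) = f"
  unfolding ribbon_structure_def reversed_def by (cases f) (use permutes_inverses(2) in force)

lemma tour_step_flags: "ribbon_structure G r \<Longrightarrow> f \<in> flags G \<Longrightarrow> tour_step r T f \<in> flags G"
  by (simp add: tour_step_eq rotate_flags flip_flags)

lemma inj_on_tour_step: "ribbon_structure G r \<Longrightarrow> inj_on (tour_step r T) (flags G)"
proof (rule inj_onI)
  fix f g assume *: "ribbon_structure G r" "f \<in> flags G" "g \<in> flags G" "tour_step r T f = tour_step r T g"
  then have "flip T f = flip T g" using injD[OF inj_rotate_flag] by (simp add: tour_step_eq)
  then show "f = g" using flip_flip[OF *(2), of T] flip_flip[OF *(3), of T] by metis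
qed

lemma ribbon_structure_reversed: "ribbon_structure G r \<Longrightarrow> ribbon_structure G (reversed r)"
  for G :: "('e::finite \<times> 'v::finite) set"
  unfolding ribbon_structure_def
proof (intro allI conjI)
  fix x assume "\<forall>x. r x permutes incident_edges G x \<and> cyclic_on (r x) (incident_edges G x)"
  then have *: "r x permutes incident_edges G x" "cyclic_on (r x) (incident_edges G x)" by auto
  show "reversed r x permutes incident_edges G x"
    using *(1) by (simp add: reversed_def permutes_inv)
  have "permutation (r x)" using *(1) by (auto simp: permutation_permutes)
  then show "cyclic_on (reversed r x) (incident_edges G x)"
    using *(2) by (simp add: reversed_def cyclic_on_def orbit_inv_eq)
qed

lemma orbit_tour_step_component:
  assumes "ribbon_structure G r" "f \<in> flags G" "g \<in> orbit (tour_step r H) f"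
  shows "g \<in> flags G \<and> fst g \<in> component H (fst f)"
proof -
  have one: "tour_step r H g \<in> flags G \<and> fst (tour_step r H g) \<in> component H (fst f)"
    if "g \<in> flags G" "fst g \<in> component H (fst f)" for g
  proof -
    obtain x \<epsilon> where g: "g = (x, \<epsilon>)" by (cases g)
    then have "\<epsilon> \<in> H \<Longrightarrow> (x, other_end x \<epsilon>) \<in> adjacent H"
      using that by (intro other_end) (auto simp: flags_iff)
    then show ?thesis
      using that tour_step_flags[OF assms(1) that(1), of H] component_step[OF that(2)] g
      by (cases "\<epsilon> \<in> H") simp_all
  qed
  show ?thesis using assms(3)
  proof induction
    case base
    show ?case by (rule one) (use assms(2) in simp_all)
  next
    case (step y)
    then show ?case by (intro one) simp_all
  qed
qed

text \<open>Induction on the edges of \<open>H\<close>, always on the flags of all of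
  \<open>G\<close>. With no edges the orbits are the cyclic rotations around single nodes. A new
  edge of a forest joins two different components; it exchanges the images of its two flags and so
  merges the two orbits.\<close>

lemma orbit_tour_step:
  assumes "ribbon_structure G r" "finite H" "forest H"
    "f \<in> flags G" "g \<in> flags G" "fst g \<in> component H (fst f)" "H \<subseteq> G" "finite G"
  shows "g \<in> orbit (tour_step r H) f"
proof -
  have fin: "finite (flags G)"
  proof (rule finite_subset)
    show "flags G \<subseteq> (\<Union>\<epsilon>\<in>G. ends \<epsilon>) \<times> G" by (auto simp: flags_iff)
    show "finite ((\<Union>\<epsilon>\<in>G. ends \<epsilon>) \<times> G)" using assms(8) finite_ends by blast
  qed
  have self: "f \<in> orbit (tour_step r H) f" if "f \<in> flags G" for f H
    using fin inj_on_tour_step[OF assms(1)] tour_step_flags[OF assms(1)] that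
    by (intro orbit_self) auto
  show ?thesis using assms(2-7)
  proof (induction H arbitrary: f g rule: finite_induct)
    case empty
    obtain x \<epsilon> \<delta> where fg: "f = (x, \<epsilon>)" "g = (x, \<delta>)"
      using empty.prems(4) by (cases f; cases g) (auto simp: component_empty)
    have "cyclic_on (r x) (incident_edges G x)"
      using assms(1) by (auto simp: ribbon_structure_def)
    then have "\<delta> \<in> orbit (r x) \<epsilon>"
      using empty.prems fg orbit_cyclic_eq3 unfolding flags_def by fast
    then have "(x, \<delta>) \<in> orbit (tour_step r {}) (x, \<epsilon>)"
    proof induction
      case base
      show ?case using orbit.base[of "tour_step r {}" "(x, \<epsilon>)"] by simp
    next
      case (step \<delta>)
      show ?case using orbit.step[OF step.IH] by simp
    qed
    then show ?case using fg by simp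
  next
    case (insert \<epsilon> H)
    obtain e v where ev: "\<epsilon> = (e, v)" by (cases \<epsilon>)
    let ?f = "tour_step r H" and ?q = "tour_step r (insert \<epsilon> H)"
    let ?a = "(Inl e, \<epsilon>)" and ?b = "(Inr v, \<epsilon>)"
    have ab: "?a \<in> flags G" "?b \<in> flags G" using insert.prems ev by auto
    have eq: "?q z = ?f z" if "z \<in> flags G" "z \<noteq> ?a" "z \<noteq> ?b" for z
      using that ev by (cases z) (auto simp: flags_iff)
    have H: "forest H" "H \<subseteq> G" using insert.prems forest_subset by blast+
    note IH = insert.IH[OF H(1) _ _ _ H(2)]
    have comp: "fst z \<in> component H (fst y) \<and> z \<in> flags G" if "z \<in> orbit ?f y" "y \<in> flags G" for y z
      using orbit_tour_step_component[OF assms(1)] that by blast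
    have "insert \<epsilon> H - {(e, v)} = H" using insert.hyps(2) ev by auto
    then have nc: "Inr v \<notin> component H (Inl e)"
      using insert.prems(1) ev by (auto simp: forest_def)
    have merged: "z \<in> orbit ?q y"
      if yz: "y \<in> flags G" "z \<in> flags G"
        "fst y \<in> component H (Inl e) \<union> component H (Inr v)"
        "fst z \<in> component H (Inl e) \<union> component H (Inr v)" for y z
    proof -
      \<comment> \<open>\<open>orbit_merge\<close> wants agreement with \<open>?f\<close> at all
        other pairs, but on pairs that are not flags \<open>?q\<close> may differ from it.\<close>
      let ?q' = "\<lambda>z. if z \<in> flags G then ?q z else ?f z"
      have orb: "y \<in> orbit ?f ?a \<union> orbit ?f ?b"
        if "y \<in> flags G" "fst y \<in> component H (Inl e) \<union> component H (Inr v)" for y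
        using that IH[of ?a y] IH[of ?b y] ab by auto
      have "z \<in> orbit ?q' y"
      proof (rule orbit_merge[where f = ?f and a = ?a and b = ?b])
        show "?b \<notin> orbit ?f ?a" using comp[of ?b ?a] nc ab by auto
        show "?q' w = ?f w" if "w \<noteq> ?a" "w \<noteq> ?b" for w using eq that by auto
      qed (use self ab ev orb yz insert.hyps(2) in auto)
      then show ?thesis
      proof induction
        case base
        then show ?case using orbit.base[of ?q y] yz(1) by simp
      next
        case (step w)
        then show ?case
          using orbit.step[OF step.IH] orbit_tour_step_component[OF assms(1) yz(1) step.IH] by simp
      qed
    qed
    have ce: "component (insert \<epsilon> H) x \<subseteq> component H x \<union> component H (Inl e) \<union> component H (Inr v)" for x
      unfolding ev by (rule component_insert)
    have sym: "fst f \<in> component (insert \<epsilon> H) (fst g)" using insert.prems(4) by (rule component_sym)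
    let ?C = "component H (Inl e) \<union> component H (Inr v)"
    show ?case
    proof (cases "fst f \<in> ?C")
      case True
      then have "fst g \<in> ?C"
        using ce[of "fst f"] insert.prems(4) by (auto dest: component_eq)
      then show ?thesis using True merged insert.prems by blast
    next
      case False
      then have "fst f \<in> component H (fst g)" using ce[of "fst g"] sym by auto
      then have "fst g \<in> component H (fst f)" by (rule component_sym)
      then have "g \<in> orbit ?f f" using IH insert.prems by blast
      then show ?thesis
      proof -
        \<comment> \<open>The orbit of \<open>f\<close> stays away from both merged components,
          hence never meets a flag of \<epsilon>.\<close>
        have "Inl e \<notin> component H (fst f)" "Inr v \<notin> component H (fst f)"
          using False component_sym[of _ H "fst f"] by auto
        then have ne: "?q z = ?f z" if "z \<in> orbit ?f f" for z
          using comp[OF that insert.prems(2)] by (intro eq) auto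
        have "f \<in> orbit ?f f" using self insert.prems(2) by blast
        from \<open>g \<in> orbit ?f f\<close> show ?thesis
        proof induction
          case base
          show ?case using orbit.base[of ?q f] ne[OF \<open>f \<in> orbit ?f f\<close>] by simp
        next
          case (step y)
          show ?case using orbit.step[OF step.IH] ne[OF step.hyps] by simp
        qed
      qed
    qed
  qed
qed


lemma precedes_in_map_upt:
  assumes "\<And>i. i < n \<Longrightarrow> p (h i) = i" "\<And>f. f \<in> S \<Longrightarrow> p f < n \<and> h (p f) = f" "f \<in> S" "g \<in> S"
  shows "precedes_in (map h [0..<n]) f g \<longleftrightarrow> p f < p g"
proof
  assume "precedes_in (map h [0..<n]) f g"
  then obtain i j where "i < j" "j < n" "h i = f" "h j = g" unfolding precedes_in_def by auto
  then show "p f < p g" using assms(1)[of i] assms(1)[of j] by simp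
next
  assume "p f < p g"
  then show "precedes_in (map h [0..<n]) f g"
    unfolding precedes_in_def using assms(2)[OF assms(3)] assms(2)[OF assms(4)]
    by (intro exI[of _ "p f"] exI[of _ "p g"]) simp
qed

text \<open>\<open>P\<close> is switched on by the step out of \<open>a\<close> and off by the step
  out of \<open>b\<close>, hence the half-open interval. It starts false and \<open>P b\<close>
  holds, so \<open>a\<close> comes first.\<close>

lemma toggle:
  assumes step: "\<And>i. i < n \<Longrightarrow> P (Suc i) = (if i = b then False else if i = a then True else P i)"
    and "\<not> P 0" "\<not> P a" "P b" "a < n" "b < n" "i < n"
  shows "a < b" "P i \<longleftrightarrow> a < i \<and> i \<le> b"
proof -
  show ab: "a < b"
  proof (rule ccontr)
    assume "\<not> a < b"
    have "\<not> P i" if "i \<le> b" for i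
      using that
    proof (induction i)
      case (Suc i)
      then show ?case using step[of i] assms \<open>\<not> a < b\<close> by auto
    qed (use assms in simp)
    then show False using \<open>P b\<close> by blast
  qed
  show "P i \<longleftrightarrow> a < i \<and> i \<le> b"
    using \<open>i < n\<close>
  proof (induction i)
    case (Suc i)
    then have "P (Suc i) = (if i = b then False else if i = a then True else a < i \<and> i \<le> b)"
      using step[of i] by simp
    then show ?case using ab by auto
  qed (use assms in simp)
qed

lemma last_longest_common_prefix:
  assumes "length xs = length ys" "k < length xs" "take (Suc k) xs = take (Suc k) ys"
    and "Suc k < length xs \<Longrightarrow> xs ! Suc k \<noteq> ys ! Suc k"
  shows "last (longest_common_prefix xs ys) = xs ! k"
proof -
  let ?l = "longest_common_prefix xs ys"
  have "prefix (take (Suc k) xs) ys" unfolding assms(3) by (rule take_is_prefix)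
  with take_is_prefix have p: "prefix (take (Suc k) xs) ?l" by (rule longest_common_prefix_max_prefix)
  then have len: "Suc k \<le> length ?l"
    using prefix_length_le[OF p] assms(2) by simp
  have pre: "prefix ?l xs" "prefix ?l ys"
    by (rule longest_common_prefix_prefix1 longest_common_prefix_prefix2)+
  then have nth: "?l ! i = xs ! i" "?l ! i = ys ! i" if "i < length ?l" for i
  proof -
    obtain zs zs' where "xs = ?l @ zs" "ys = ?l @ zs'" using pre by (auto simp: prefix_def)
    then show "?l ! i = xs ! i" "?l ! i = ys ! i" using that nth_append[of ?l _ i] by metis+
  qed
  have "length ?l \<le> length xs" using pre(1) by (rule prefix_length_le)
  then have "\<not> Suc k < length ?l"
    using assms(4) nth[of "Suc k"] by auto
  then have "length ?l = Suc k" using len by simp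
  then show ?thesis using nth(1)[of k] by (subst last_conv_nth) auto
qed

section \<open>Tours of spanning trees as enumerations of the flags\<close>

locale ribbon_graph =
  fixes G :: "('e::finite \<times> 'v::finite) set"
    and r :: "('e, 'v) ribbon"
    and b0 :: "('e, 'v) node"
    and \<beta> :: "('e, 'v) edge"
  assumes connected: "connected_graph G"
    and ribbon: "ribbon_structure G r"
    and base: "\<beta> \<in> incident_edges G b0"
begin

definition flag :: "('e \<times> 'v) set \<Rightarrow> nat \<Rightarrow> ('e, 'v) node \<times> ('e, 'v) edge" where
  "flag T i = (tour_step r T ^^ i) (b0, \<beta>)"

text \<open>The time at which a flag is current, meaningful for spanning trees, whose tours visit
  each flag exactly once.\<close>

definition pos :: "('e \<times> 'v) set \<Rightarrow> ('e, 'v) node \<times> ('e, 'v) edge \<Rightarrow> nat" where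
  "pos T = the_inv_into {..<card (flags G)} (flag T)"

lemma flag_0 [simp]: "flag T 0 = (b0, \<beta>)"
  by (simp add: flag_def)

lemma flag_Suc: "flag T (Suc i) = tour_step r T (flag T i)"
  by (simp add: flag_def)

lemma base_flag: "(b0, \<beta>) \<in> flags G"
  using base by (simp add: flags_def)

lemma flag_in: "flag T i \<in> flags G"
  by (induction i) (simp_all add: base_flag flag_Suc tour_step_flags[OF ribbon])

lemma orbit_base:
  assumes "spanning_tree G T"
  shows "orbit (tour_step r T) (b0, \<beta>) = flags G"
proof (intro subset_antisym subsetI)
  fix f assume "f \<in> orbit (tour_step r T) (b0, \<beta>)"
  then show "f \<in> flags G" using orbit_tour_step_component[OF ribbon base_flag] by blast
next
  fix f assume f: "f \<in> flags G"
  have "fst f \<in> component T (fst (b0, \<beta>))"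
    using assms by (simp add: spanning_tree_iff connected_graph_def)
  then show "f \<in> orbit (tour_step r T) (b0, \<beta>)"
    using assms by (intro orbit_tour_step[OF ribbon _ _ base_flag f]) (simp_all add: spanning_tree_iff)
qed

lemma
  assumes "spanning_tree G T"
  shows tour_eq: "tour r b0 \<beta> T = map (flag T) [0..<card (flags G)]"
    and bij_flag: "bij_betw (flag T) {..<card (flags G)} (flags G)"
    and flag_period: "flag T (card (flags G)) = (b0, \<beta>)"
proof -
  have fin: "finite (flags G)" by simp
  note enum = orbit_enumeration[OF orbit_base[OF assms] base_flag fin]
  have eq: "(\<lambda>i. (tour_step r T ^^ i) (b0, \<beta>)) = flag T" by (simp add: flag_def fun_eq_iff)
  show "tour r b0 \<beta> T = map (flag T) [0..<card (flags G)]"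
    unfolding tour_def enum(1) eq by (rule refl)
  show "bij_betw (flag T) {..<card (flags G)} (flags G)" using enum(2) unfolding eq .
  show "flag T (card (flags G)) = (b0, \<beta>)" using enum(3) unfolding flag_def .
qed

lemma pos_less: "spanning_tree G T \<Longrightarrow> f \<in> flags G \<Longrightarrow> pos T f < card (flags G)"
  unfolding pos_def using bij_betw_the_inv_into[OF bij_flag] by (blast dest: bij_betwE)

lemma flag_pos: "spanning_tree G T \<Longrightarrow> f \<in> flags G \<Longrightarrow> flag T (pos T f) = f"
  unfolding pos_def by (rule f_the_inv_into_f_bij_betw[OF bij_flag]) auto

lemma pos_flag: "spanning_tree G T \<Longrightarrow> i < card (flags G) \<Longrightarrow> pos T (flag T i) = i"
  unfolding pos_def by (rule the_inv_into_f_f[OF bij_betw_imp_inj_on[OF bij_flag]]) auto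

lemma pos_eq_iff:
  "spanning_tree G T \<Longrightarrow> f \<in> flags G \<Longrightarrow> i < card (flags G) \<Longrightarrow> flag T i = f \<longleftrightarrow> i = pos T f"
  using flag_pos pos_flag by metis

lemma precedes_in_violet_tour:
  assumes "spanning_tree G T" "f \<in> flags G" "g \<in> flags G"
  shows "precedes_in (violet_tour r b0 \<beta> T) f g \<longleftrightarrow> pos T f < pos T g"
  unfolding tour_eq[OF assms(1)]
  by (rule precedes_in_map_upt[where S = "flags G"])
    (simp_all add: assms pos_flag flag_pos pos_less)

text \<open>
  Writing \<open>\<phi>\<close> for \<open>flip T\<close> and \<open>\<rho>\<close> for the rotation, the violet step is \<open>\<rho> \<phi>\<close> and the emerald step is
  \<open>\<rho>\<^sup>-\<^sup>1 \<phi> = \<phi> (\<rho> \<phi>)\<^sup>-\<^sup>1 \<phi>\<close>. Hence the emerald tour is the flipped and reversed violet tour.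
\<close>

lemma precedes_in_emerald_tour:
  assumes T: "spanning_tree G T" and fg: "f \<in> flags G" "g \<in> flags G"
  shows "precedes_in (emerald_tour r b0 \<beta> T) f g \<longleftrightarrow> pos T (flip T g) < pos T (flip T f)"
proof -
  let ?N = "card (flags G)"
  have "r b0 permutes incident_edges G b0" using ribbon by (simp add: ribbon_structure_def)
  then have inv: "r b0 (inv (r b0) \<beta>) = \<beta>" "inv (r b0) \<beta> \<in> incident_edges G b0"
    using base by (simp_all add: permutes_inverses permutes_in_image[OF permutes_inv])
  interpret e: ribbon_graph G "reversed r" b0 "inv (r b0) \<beta>"
    by unfold_locales (simp_all add: connected ribbon_structure_reversed ribbon inv)
  have N: "?N > 0" using base_flag by (auto simp: card_gt_0_iff)
  have prev_flag: "rotate_flag (reversed r) (flag T (Suc i)) = flip T (flag T i)" for i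
    by (simp add: flag_Suc tour_step_eq reversed_rotate_flag[OF ribbon])
  \<comment> \<open>The start matches because the violet tour is back at the base flag after
    \<open>?N\<close> steps, so that its flag at time \<open>?N - 1\<close> flips to the emerald
    base flag.\<close>
  have eq: "e.flag T i = flip T (flag T (?N - 1 - i))" if "i < ?N" for i
    using that
  proof (induction i)
    case 0
    have "rotate_flag (reversed r) (b0, \<beta>) = flip T (flag T (?N - 1))"
      using prev_flag[of "?N - 1"] N by (simp add: flag_period[OF T])
    moreover have "rotate_flag (reversed r) (b0, \<beta>) = (b0, inv (r b0) \<beta>)"
      by (simp add: reversed_def)
    ultimately show ?case by simp
  next
    case (Suc i)
    have "e.flag T (Suc i) = rotate_flag (reversed r) (flip T (flip T (flag T (?N - 1 - i))))"
      using Suc by (simp add: e.flag_Suc tour_step_eq)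
    also have "\<dots> = rotate_flag (reversed r) (flag T (Suc (?N - 1 - Suc i)))"
      using Suc.prems by (simp only: flip_flip[OF flag_in]) (simp add: Suc_diff_Suc)
    finally show ?case by (simp only: prev_flag)
  qed
  define p where "p f = ?N - 1 - pos T (flip T f)" for f
  have p: "p f < ?N \<and> flip T (flag T (?N - 1 - p f)) = f" if "f \<in> flags G" for f
  proof -
    have "pos T (flip T f) < ?N" using pos_less[OF T flip_flags[OF that]] .
    then have "?N - 1 - p f = pos T (flip T f)" by (simp add: p_def)
    then show ?thesis
      using N by (simp add: flag_pos[OF T flip_flags[OF that]] flip_flip[OF that] p_def)
  qed
  have "emerald_tour r b0 \<beta> T = map (\<lambda>i. flip T (flag T (?N - 1 - i))) [0..<?N]"
    unfolding e.tour_eq[OF T] by (simp add: eq)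
  moreover have "precedes_in \<dots> f g \<longleftrightarrow> p f < p g"
  proof (rule precedes_in_map_upt[where S = "flags G"])
    show "p (flip T (flag T (?N - 1 - i))) = i" if "i < ?N" for i
      unfolding p_def flip_flip[OF flag_in] using that by (simp add: pos_flag[OF T])
  qed (use p fg in auto)
  moreover have "p f < p g \<longleftrightarrow> pos T (flip T g) < pos T (flip T f)"
    using pos_less[OF T flip_flags[OF fg(1)], of T] pos_less[OF T flip_flags[OF fg(2)], of T]
    unfolding p_def by linarith
  ultimately show ?thesis by simp
qed

text \<open>Skipping keeps the node, and every other tree edge has both ends on one side. Sides
  change only by traversing \<open>(e, v)\<close>: out of the shore from \<open>Inl e\<close>, into
  it from \<open>Inr v\<close>.\<close>

lemma shore_step:
  assumes T: "spanning_tree G T" and ev: "(e, v) \<in> T" and i: "i < card (flags G)"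
  shows "fst (flag T (Suc i)) \<in> shore T (e, v) \<longleftrightarrow>
    (if i = pos T (Inl e, (e, v)) then False else if i = pos T (Inr v, (e, v)) then True
     else fst (flag T i) \<in> shore T (e, v))"
proof -
  obtain x e' v' where f: "flag T i = (x, (e', v'))" by (metis surj_pair)
  have G: "(e, v) \<in> G" "forest T" using T ev by (auto simp: spanning_tree_iff)
  have pos: "i = pos T (Inl e, (e, v)) \<longleftrightarrow> flag T i = (Inl e, (e, v))"
    "i = pos T (Inr v, (e, v)) \<longleftrightarrow> flag T i = (Inr v, (e, v))"
    using pos_eq_iff[OF T _ i] G by auto
  have x: "x = Inl e' \<or> x = Inr v'" using flag_in[of T i] f by (auto simp: flags_iff)
  have "fst (flag T (Suc i)) = (if (e', v') \<in> T then other_end x (e', v') else x)"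
    by (simp add: flag_Suc f)
  then show ?thesis
    unfolding pos f using x ev Inr_shore[OF G(2) ev] shore_edge[of e' v' T "(e, v)"] by auto
qed

text \<open>An instance of \<open>toggle\<close> that starts outside the shore; the flag at
  \<open>Inr v\<close> is the last one outside, the flag at \<open>Inl e\<close> the last one
  inside.\<close>

lemma shore_interval:
  assumes T: "spanning_tree G T" and ev: "(e, v) \<in> T" and b0: "b0 \<notin> shore T (e, v)"
  shows "pos T (Inr v, (e, v)) < pos T (Inl e, (e, v))"
    and "f \<in> flags G \<Longrightarrow> fst f \<in> shore T (e, v) \<longleftrightarrow>
      pos T (Inr v, (e, v)) < pos T f \<and> pos T f \<le> pos T (Inl e, (e, v))"
proof -
  have G: "(e, v) \<in> G" "forest T" using T ev by (auto simp: spanning_tree_iff)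
  let ?P = "\<lambda>i. fst (flag T i) \<in> shore T (e, v)"
  note toggle = toggle[where P = ?P and n = "card (flags G)", OF shore_step[OF T ev]]
  have end_pos: "pos T (Inr v, (e, v)) < card (flags G)" "pos T (Inl e, (e, v)) < card (flags G)"
    "\<not> ?P (pos T (Inr v, (e, v)))" "?P (pos T (Inl e, (e, v)))" "\<not> ?P 0"
    using G ev b0 by (simp_all add: pos_less[OF T] flag_pos[OF T] Inr_shore)
  show "pos T (Inr v, (e, v)) < pos T (Inl e, (e, v))"
    by (rule toggle(1)) (use end_pos in simp_all)
  show "fst f \<in> shore T (e, v) \<longleftrightarrow>
      pos T (Inr v, (e, v)) < pos T f \<and> pos T f \<le> pos T (Inl e, (e, v))" if "f \<in> flags G"
    using toggle(2)[of "pos T f"] end_pos pos_less[OF T that] flag_pos[OF T that] by simp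
qed

lemma shore_interval':
  assumes T: "spanning_tree G T" and ev: "(e, v) \<in> T" and b0: "b0 \<in> shore T (e, v)"
  shows "pos T (Inl e, (e, v)) < pos T (Inr v, (e, v))"
    and "f \<in> flags G \<Longrightarrow> fst f \<notin> shore T (e, v) \<longleftrightarrow>
      pos T (Inl e, (e, v)) < pos T f \<and> pos T f \<le> pos T (Inr v, (e, v))"
proof -
  have G: "(e, v) \<in> G" "forest T" using T ev by (auto simp: spanning_tree_iff)
  let ?P = "\<lambda>i. fst (flag T i) \<notin> shore T (e, v)"
  have step: "?P (Suc i) = (if i = pos T (Inr v, (e, v)) then False
      else if i = pos T (Inl e, (e, v)) then True else ?P i)" if "i < card (flags G)" for i
  proof -
    \<comment> \<open>For the complement of the shore the two tests of \<open>shore_step\<close>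
      must change places.\<close>
    have "pos T (Inl e, (e, v)) \<noteq> pos T (Inr v, (e, v))"
      using flag_pos[OF T, of "(Inl e, (e, v))"] flag_pos[OF T, of "(Inr v, (e, v))"] G by auto
    then show ?thesis using shore_step[OF T ev that] by auto
  qed
  note toggle = toggle[where P = ?P and n = "card (flags G)", OF step]
  have end_pos: "pos T (Inr v, (e, v)) < card (flags G)" "pos T (Inl e, (e, v)) < card (flags G)"
    "?P (pos T (Inr v, (e, v)))" "\<not> ?P (pos T (Inl e, (e, v)))" "\<not> ?P 0"
    using G ev b0 by (simp_all add: pos_less[OF T] flag_pos[OF T] Inr_shore)
  show "pos T (Inl e, (e, v)) < pos T (Inr v, (e, v))"
    by (rule toggle(1)) (use end_pos in simp_all)
  show "fst f \<notin> shore T (e, v) \<longleftrightarrow>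
      pos T (Inl e, (e, v)) < pos T f \<and> pos T f \<le> pos T (Inr v, (e, v))" if "f \<in> flags G"
    using toggle(2)[of "pos T f"] end_pos pos_less[OF T that] flag_pos[OF T that] by simp
qed

section \<open>The violet order and the emerald order\<close>

lemma jaeger_iff:
  "T \<in> V_cut_Jaeger_trees G r b0 \<beta> \<longleftrightarrow> spanning_tree G T \<and>
    (\<forall>e v. (e, v) \<in> G - T \<longrightarrow> pos T (Inr v, (e, v)) < pos T (Inl e, (e, v)))"
proof -
  have "(\<forall>(e, v) \<in> G - T. precedes_in (violet_tour r b0 \<beta> T) (Inr v, (e, v)) (Inl e, (e, v))) \<longleftrightarrow>
      (\<forall>e v. (e, v) \<in> G - T \<longrightarrow> pos T (Inr v, (e, v)) < pos T (Inl e, (e, v)))"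
    if T: "spanning_tree G T"
  proof -
    have "precedes_in (violet_tour r b0 \<beta> T) (Inr v, (e, v)) (Inl e, (e, v)) \<longleftrightarrow>
        pos T (Inr v, (e, v)) < pos T (Inl e, (e, v))" if "(e, v) \<in> G" for e v
      using that by (intro precedes_in_violet_tour[OF T]) simp_all
    then show ?thesis by fast
  qed
  then show ?thesis unfolding V_cut_Jaeger_trees_def by blast
qed

lemma jaegerD:
  assumes "T \<in> V_cut_Jaeger_trees G r b0 \<beta>"
  shows "spanning_tree G T" "T \<subseteq> G" "connected_graph T" "forest T"
  using assms by (simp_all add: jaeger_iff spanning_tree_iff)

text \<open>If the base node is in the shore, every opposite edge comes after \<open>(e, v)\<close>
  in the emerald order, so none is smallest. Otherwise every opposite edge comes before all edges of
  the direction of \<open>(e, v)\<close>, so the smallest edge is opposite as soon as an opposite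
  one exists.\<close>

lemma semi_passive_iff:
  assumes J: "T \<in> V_cut_Jaeger_trees G r b0 \<beta>" and ev: "(e, v) \<in> T"
  shows "internally_semi_passive G (emerald_less r b0 \<beta> T) T (e, v) \<longleftrightarrow>
    b0 \<notin> shore T (e, v) \<and> (\<exists>e' v'. (e', v') \<in> G \<and> Inl e' \<notin> shore T (e, v) \<and> Inr v' \<in> shore T (e, v))"
proof -
  note T = jaegerD(1)[OF J]
  let ?A = "shore T (e, v)"
  \<comment> \<open>The violet time of the flipped flag: emerald-smaller means larger
    \<open>key\<close>. Flipping matters for \<open>(e, v)\<close> itself, whose key is the visit at
    its end in V.\<close>
  define key where "key \<delta> = pos T (flip T (Inl (fst \<delta>), \<delta>))" for \<delta>
  have less: "emerald_less r b0 \<beta> T \<delta> \<delta>' \<longleftrightarrow> key \<delta>' < key \<delta>" if "\<delta> \<in> G" "\<delta>' \<in> G" for \<delta> \<delta>'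
    unfolding emerald_less_def key_def using that
    by (intro precedes_in_emerald_tour[OF T]; cases \<delta>; cases \<delta>'; simp)
  have cut: "(e', v') \<in> fundamental_cut G T (e, v) \<longleftrightarrow>
      (e', v') \<in> G \<and> (Inl e' \<in> ?A) \<noteq> (Inr v' \<in> ?A)" for e' v'
    by (rule fundamental_cut_iff[OF jaegerD(3,4)[OF J] ev])
  have compl: "component (T - {(e, v)}) (Inr v) = - ?A"
    by (rule shore_compl[OF jaegerD(3,4)[OF J] ev])
  have isp: "internally_semi_passive G (emerald_less r b0 \<beta> T) T (e, v) \<longleftrightarrow>
      (\<exists>e' v'. (e', v') \<in> G \<and> Inl e' \<notin> ?A \<and> Inr v' \<in> ?A \<and>
        (\<forall>f \<in> fundamental_cut G T (e, v). f \<noteq> (e', v') \<longrightarrow> key f < key (e', v')))"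
    (is "_ \<longleftrightarrow> ?R")
  proof -
    have "fundamental_cut G T (e, v) \<subseteq> G" by (auto simp: fundamental_cut_def)
    then have eq: "(\<forall>f' \<in> fundamental_cut G T (e, v). f' \<noteq> f \<longrightarrow> emerald_less r b0 \<beta> T f f') \<longleftrightarrow>
        (\<forall>f' \<in> fundamental_cut G T (e, v). f' \<noteq> f \<longrightarrow> key f' < key f)"
      if "f \<in> fundamental_cut G T (e, v)" for f
      using that less by blast
    have "component (T - {(e, v)}) (Inl e) = ?A" by (simp add: shore_def)
    then have "internally_semi_passive G (emerald_less r b0 \<beta> T) T (e, v) \<longleftrightarrow>
      (\<exists>f \<in> fundamental_cut G T (e, v).
        (\<forall>f' \<in> fundamental_cut G T (e, v). f' \<noteq> f \<longrightarrow> emerald_less r b0 \<beta> T f f') \<and>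
        Inr (snd f) \<in> ?A \<and> Inl (fst f) \<in> - ?A)"
      unfolding internally_semi_passive_def using ev by (simp add: compl)
    also have "\<dots> \<longleftrightarrow> (\<exists>f \<in> fundamental_cut G T (e, v).
        (\<forall>f' \<in> fundamental_cut G T (e, v). f' \<noteq> f \<longrightarrow> key f' < key f) \<and>
        Inr (snd f) \<in> ?A \<and> Inl (fst f) \<in> - ?A)"
      by (rule bex_cong[OF refl]) (simp only: eq)
    also have "\<dots> \<longleftrightarrow> ?R"
      unfolding Bex_def split_paired_Ex cut fst_conv snd_conv by blast
    finally show ?thesis .
  qed
  have GT: "(e, v) \<in> G" using jaegerD(2)[OF J] ev by blast
  have key_ev: "key (e, v) = pos T (Inr v, (e, v))" using ev by (simp add: key_def)
  have nonT: "(e', v') \<notin> T" if "(Inl e' \<in> ?A) \<noteq> (Inr v' \<in> ?A)" "(e', v') \<noteq> (e, v)" for e' v'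
    using shore_edge[of e' v' T "(e, v)"] that by blast
  have key: "key (e', v') = pos T (Inl e', (e', v'))"
    if "(Inl e' \<in> ?A) \<noteq> (Inr v' \<in> ?A)" "(e', v') \<noteq> (e, v)" for e' v'
    using nonT[OF that] by (simp add: key_def)
  have cut_V: "pos T (Inr v', (e', v')) < pos T (Inl e', (e', v'))"
    if "(Inl e' \<in> ?A) \<noteq> (Inr v' \<in> ?A)" "(e', v') \<noteq> (e, v)" "(e', v') \<in> G" for e' v'
    using nonT[OF that(1,2)] that(3) J by (auto simp: jaeger_iff)
  have opposite_ne: "(e', v') \<noteq> (e, v)" if "Inl e' \<notin> ?A" for e' v' using that by auto
  show ?thesis
  proof (cases "b0 \<in> ?A")
    case True
    note iv = shore_interval'[OF T ev True]
    \<comment> \<open>The complement of the shore is visited up to time \<open>key (e, v)\<close>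
      only, and the end in E lies there.\<close>
    have le: "key (e', v') \<le> key (e, v)" if "(e', v') \<in> G" "Inl e' \<notin> ?A" "Inr v' \<in> ?A" for e' v'
      using iv(2)[of "(Inl e', (e', v'))"] key[OF _ opposite_ne] that key_ev by auto
    have "(e, v) \<in> fundamental_cut G T (e, v)"
      using cut GT Inr_shore[OF jaegerD(4)[OF J] ev] by simp
    then have "\<not> key (e', v') \<le> key (e, v)"
      if "\<forall>f \<in> fundamental_cut G T (e, v). f \<noteq> (e', v') \<longrightarrow> key f < key (e', v')" "Inl e' \<notin> ?A" for e' v'
      using that opposite_ne[OF that(2), of v'] by fastforce
    then have "\<not> ?R" using le by blast
    then show ?thesis using isp True by blast
  next
    case False
    note iv = shore_interval[OF T ev False]
    have same: "key (e', v') \<le> pos T (Inl e, (e, v))"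
      if "(e', v') \<in> G" "Inl e' \<in> ?A" "Inr v' \<notin> ?A" for e' v'
      using iv(1) iv(2)[of "(Inl e', (e', v'))"] key[of e' v'] that key_ev
      by (cases "(e', v') = (e, v)") auto
    \<comment> \<open>The end in V is inside the shore and, the edge being cut in V, is visited
      first. The end in E is outside, so its visit falls after the whole interval.\<close>
    have opp: "pos T (Inl e, (e, v)) < key (e', v')"
      if "(e', v') \<in> G" "Inl e' \<notin> ?A" "Inr v' \<in> ?A" for e' v'
      using iv(2)[of "(Inl e', (e', v'))"] iv(2)[of "(Inr v', (e', v'))"]
        key[OF _ opposite_ne] cut_V[OF _ opposite_ne] that by fastforce
    let ?O = "{(e', v'). (e', v') \<in> G \<and> Inl e' \<notin> ?A \<and> Inr v' \<in> ?A}"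
    have inj: "inj_on key G"
    proof (rule inj_onI)
      fix f g assume fg: "f \<in> G" "g \<in> G" "key f = key g"
      have "(Inl (fst f), f) \<in> flags G" "(Inl (fst g), g) \<in> flags G"
        using fg by (cases f; cases g; simp)+
      then have "flip T (Inl (fst f), f) = flip T (Inl (fst g), g)"
        using fg(3) flag_pos[OF T flip_flags] unfolding key_def by metis
      then show "f = g" by (simp add: prod_eq_iff split: if_splits)
    qed
    have "?thesis" if nonempty: "?O \<noteq> {}"
    proof -
      obtain m where m: "m \<in> ?O" "\<And>g. g \<in> ?O \<Longrightarrow> key g \<le> key m"
      proof -
        have "Max (key ` ?O) \<in> key ` ?O" using nonempty by (intro Max_in) simp_all
        then obtain m where "m \<in> ?O" "key m = Max (key ` ?O)" by fastforce
        then show ?thesis using that[of m] Max_ge[of "key ` ?O"] by simp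
      qed
      obtain e' v' where [simp]: "m = (e', v')" by (cases m)
      have "key f < key m" if f: "f \<in> fundamental_cut G T (e, v)" "f \<noteq> m" for f
      proof -
        obtain e'' v'' where f_eq [simp]: "f = (e'', v'')" by (cases f)
        have c: "(e'', v'') \<in> G" "(Inl e'' \<in> ?A) \<noteq> (Inr v'' \<in> ?A)" using f(1) cut by auto
        show ?thesis
        proof (cases "Inl e'' \<in> ?A")
          case True
          then show ?thesis using same[of e'' v''] opp[of e' v'] c m(1) by auto
        next
          case False
          then have "f \<in> ?O" using c by auto
          then have "key f \<le> key m" by (rule m(2))
          moreover have "key f \<noteq> key m" using inj_onD[OF inj] f(2) c(1) m(1) by auto
          ultimately show ?thesis by simp
        qed
      qed
      then have "\<forall>f \<in> fundamental_cut G T (e, v). f \<noteq> (e', v') \<longrightarrow> key f < key (e', v')" by simp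
      moreover have "(e', v') \<in> G" "Inl e' \<notin> ?A" "Inr v' \<in> ?A" using m(1) by simp_all
      ultimately have "?R" by blast
      then show ?thesis using isp False m(1) by auto
    qed
    then show ?thesis unfolding isp using False by auto
  qed
qed

section \<open>First differences of two tours\<close>

definition first_difference :: "('e \<times> 'v) set \<Rightarrow> ('e \<times> 'v) set \<Rightarrow> nat \<Rightarrow> bool" where
  "first_difference T T' k \<longleftrightarrow> k < card (flags G) \<and> (\<forall>i\<le>k. flag T i = flag T' i) \<and>
    (\<forall>i<k. snd (flag T i) \<in> T \<longleftrightarrow> snd (flag T i) \<in> T') \<and>
    (snd (flag T k) \<in> T \<longleftrightarrow> snd (flag T k) \<notin> T')"

lemma first_difference_sym: "first_difference T T' k \<Longrightarrow> first_difference T' T k"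
  unfolding first_difference_def by auto

lemma flag_eq_upto:
  assumes "\<And>i. i < k \<Longrightarrow> snd (flag T i) \<in> T \<longleftrightarrow> snd (flag T i) \<in> T'"
  shows "i \<le> k \<Longrightarrow> flag T i = flag T' i"
proof (induction i)
  case (Suc i)
  then have "flag T i = flag T' i" by simp
  moreover have "snd (flag T i) \<in> T \<longleftrightarrow> snd (flag T i) \<in> T'" using assms[of i] Suc.prems by simp
  ultimately show ?case by (cases "flag T' i") (simp add: flag_Suc)
qed simp

text \<open>The next flag depends only on the current one and on whether its edge is in the tree, so
  the tours agree up to the first differing decision. That decision comes no later than the visit of
  any edge in just one of the trees.\<close>

lemma first_difference_exists:
  assumes T: "spanning_tree G T" and T': "spanning_tree G T'" and f: "f \<in> flags G"
    and ne: "snd f \<in> T \<longleftrightarrow> snd f \<notin> T'"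
  shows "\<exists>k \<le> pos T f. first_difference T T' k"
proof -
  let ?D = "\<lambda>i. snd (flag T i) \<in> T \<longleftrightarrow> snd (flag T i) \<notin> T'"
  define k where "k = (LEAST i. ?D i)"
  have D: "?D (pos T f)" using flag_pos[OF T f] ne by simp
  have k: "?D k" "k \<le> pos T f" "\<And>i. i < k \<Longrightarrow> \<not> ?D i"
    unfolding k_def by (rule LeastI[of ?D, OF D], rule Least_le[of ?D, OF D], rule not_less_Least)
  have "first_difference T T' k"
    unfolding first_difference_def
  proof (intro conjI allI impI)
    show "k < card (flags G)" using k(2) pos_less[OF T f] by simp
    show "flag T i = flag T' i" if "i \<le> k" for i
      using flag_eq_upto[of k T T' i] k(3) that by blast
  qed (use k in blast)+
  then show ?thesis using k(2) by blast
qed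

lemma first_difference_neq:
  assumes "spanning_tree G T" "spanning_tree G T'" "T \<noteq> T'"
  shows "\<exists>k. first_difference T T' k"
proof -
  obtain \<epsilon> where "\<epsilon> \<in> T \<longleftrightarrow> \<epsilon> \<notin> T'" using assms(3) by blast
  moreover from this have "\<epsilon> \<in> G" using assms(1,2) by (auto simp: spanning_tree_iff)
  ultimately show ?thesis
    using first_difference_exists[OF assms(1,2), of "(Inl (fst \<epsilon>), \<epsilon>)"]
    by (cases \<epsilon>) auto
qed

text \<open>After time \<open>k\<close> one tour stays at the node while the other moves to the
  opposite end, so the common prefix ends exactly at \<open>k\<close>.\<close>

lemma violet_less_iff:
  assumes T: "spanning_tree G T" "spanning_tree G T'" and k: "first_difference T T' k"
  shows "violet_less r b0 \<beta> T T' \<longleftrightarrow> snd (flag T k) \<in> T'"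
proof -
  let ?N = "card (flags G)"
  have kN: "k < ?N" and eq: "\<And>i. i \<le> k \<Longrightarrow> flag T i = flag T' i"
    and ne: "snd (flag T k) \<in> T \<longleftrightarrow> snd (flag T k) \<notin> T'"
    using k by (auto simp: first_difference_def)
  have "fst (flag T k) \<in> ends (snd (flag T k))"
    using flag_in[of T k] by (cases "flag T k") (auto simp: flags_iff)
  then have "other_end (fst (flag T k)) (snd (flag T k)) \<noteq> fst (flag T k)" by (rule other_end)
  then have "flag T (Suc k) \<noteq> flag T' (Suc k)"
    using ne eq[of k] by (cases "flag T' k") (auto simp: flag_Suc split: if_splits)
  then have "last (longest_common_prefix (map (flag T) [0..<?N]) (map (flag T') [0..<?N])) = flag T k"
    using kN eq
    by (subst last_longest_common_prefix[where k = k]) (auto simp: take_map simp del: upt_Suc)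
  moreover have "T \<noteq> T'" using ne by auto
  ultimately show ?thesis unfolding violet_less_def by (simp add: tour_eq T)
qed

text \<open>
  The decision of the tour of \<open>T\<close> at its \<open>i\<close>-th flag is \<open>True\<close> if it traverses an edge at a node in \<open>V\<close> or
  skips an edge at a node in \<open>E\<close>. On Jaeger trees the violet order is the lexicographic order of the
  decisions, and among all spanning trees whose simplex contains a given point the lexicographically
  smallest one is Jaeger.
\<close>

definition decisions :: "('e \<times> 'v) set \<Rightarrow> bool list" where
  "decisions T = map (\<lambda>i. isl (fst (flag T i)) \<longleftrightarrow> snd (flag T i) \<notin> T) [0..<card (flags G)]"

abbreviation lex_less :: "('e \<times> 'v) set rel" where
  "lex_less \<equiv> inv_image (lex {(False, True)}) decisions"

text \<open>The second premise says that the decision of \<open>T\<close> at time \<open>k\<close>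
  is \<open>False\<close>.\<close>

lemma lex_lessI:
  assumes "first_difference T T' k" "isl (fst (flag T k)) \<longleftrightarrow> snd (flag T k) \<in> T"
  shows "(T, T') \<in> lex_less"
proof -
  have k: "k < card (flags G)" using assms(1) by (simp add: first_difference_def)
  let ?d = "decisions T" and ?d' = "decisions T'"
  have "?d ! k = False" "?d' ! k = True"
    using assms k by (auto simp: decisions_def first_difference_def)
  moreover have "take k ?d = take k ?d'"
    using assms(1) by (auto simp: decisions_def list_eq_iff_nth_eq first_difference_def)
  moreover have "length ?d = card (flags G)" "length ?d' = card (flags G)"
    by (simp_all add: decisions_def)
  ultimately have "?d = take k ?d @ False # drop (Suc k) ?d" "?d' = take k ?d @ True # drop (Suc k) ?d'"
    using id_take_nth_drop[of k ?d] id_take_nth_drop[of k ?d'] k by simp_all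
  then have "\<exists>xs ys zs. ?d = xs @ False # ys \<and> ?d' = xs @ True # zs" by blast
  then show ?thesis
    unfolding in_inv_image lex_conv by (auto simp: decisions_def)
qed

lemma wf_lex_less: "wf lex_less"
proof -
  have "wf {(False, True)}" by (rule wfI[where A = "{False}" and B = "{True}"]) auto
  then show ?thesis by (intro wf_inv_image wf_lex)
qed

lemma trans_lex_less: "trans lex_less"
  by (intro trans_inv_image lex_transI) (auto simp: trans_def)

text \<open>Neither tour has met the edge before time \<open>k\<close>. Were it met at its end in E,
  then \<open>T\<close>, which lacks it, would cut it there.\<close>

lemma jaeger_first_difference:
  assumes J: "T \<in> V_cut_Jaeger_trees G r b0 \<beta>" and J': "T' \<in> V_cut_Jaeger_trees G r b0 \<beta>"
    and k: "first_difference T T' k" and \<delta>: "snd (flag T k) \<in> T'"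
  obtains e v where "flag T k = (Inr v, (e, v))" "(e, v) \<in> T'" "(e, v) \<notin> T"
    "pos T' (Inr v, (e, v)) = k" "k < pos T' (Inl e, (e, v))"
proof -
  note T = jaegerD(1)[OF J] and T' = jaegerD(1)[OF J']
  have kN: "k < card (flags G)" and eq: "\<And>i. i \<le> k \<Longrightarrow> flag T i = flag T' i"
    and before: "\<And>i. i < k \<Longrightarrow> snd (flag T i) \<in> T \<longleftrightarrow> snd (flag T i) \<in> T'"
    using k by (auto simp: first_difference_def)
  obtain x e v where f: "flag T k = (x, (e, v))" by (metis surj_pair)
  have ev: "(e, v) \<in> T'" "(e, v) \<notin> T" using k \<delta> f by (auto simp: first_difference_def)
  have G: "(e, v) \<in> G" using flag_in[of T k] f by (auto simp: flags_iff)
  have x: "x = Inl e \<or> x = Inr v" using flag_in[of T k] f by (auto simp: flags_iff)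
  have late: "k \<le> pos T g" "k \<le> pos T' g" if "snd g = (e, v)" "g \<in> flags G" for g
  proof -
    show "k \<le> pos T g"
      using before[of "pos T g"] that ev flag_pos[OF T that(2)] by (metis not_le)
    show "k \<le> pos T' g"
      using before[of "pos T' g"] eq[of "pos T' g"] that ev flag_pos[OF T' that(2)]
      by (metis not_le less_imp_le)
  qed
  have "x \<noteq> Inl e"
  proof
    assume "x = Inl e"
    then have "pos T (Inl e, (e, v)) = k" using f pos_flag[OF T kN] by simp
    moreover have "pos T (Inr v, (e, v)) < pos T (Inl e, (e, v))"
      using J G ev by (simp add: jaeger_iff)
    ultimately show False using late(1)[of "(Inr v, (e, v))"] G by simp
  qed
  then have x: "x = Inr v" using x by blast
  then have "pos T' (Inr v, (e, v)) = k" using pos_flag[OF T' kN] eq[of k] f by simp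
  moreover have "k \<noteq> pos T' (Inl e, (e, v))"
    using flag_pos[OF T', of "(Inl e, (e, v))"] eq[of k] f x G by auto
  then have "k < pos T' (Inl e, (e, v))"
    using late(2)[of "(Inl e, (e, v))"] G by simp
  ultimately show ?thesis using that f x ev by blast
qed

text \<open>Two Jaeger trees separate at a node in V, where traversing is the decision
  \<open>True\<close>, so the tree containing the edge is larger in both orders. This gives
  transitivity of the violet order.\<close>

lemma violet_less_lex:
  assumes J: "T \<in> V_cut_Jaeger_trees G r b0 \<beta>" and J': "T' \<in> V_cut_Jaeger_trees G r b0 \<beta>"
  shows "violet_less r b0 \<beta> T T' \<longleftrightarrow> (T, T') \<in> lex_less"
proof -
  note T = jaegerD(1)[OF J] and T' = jaegerD(1)[OF J']
  have lex: "(T, T') \<in> lex_less"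
    if J: "T \<in> V_cut_Jaeger_trees G r b0 \<beta>" "T' \<in> V_cut_Jaeger_trees G r b0 \<beta>"
      and k: "first_difference T T' k" "snd (flag T k) \<in> T'" for T T' k
  proof -
    obtain e v where "flag T k = (Inr v, (e, v))" "(e, v) \<notin> T"
      by (rule jaeger_first_difference[OF J k])
    then show ?thesis by (intro lex_lessI[OF k(1)]) simp
  qed
  show ?thesis
  proof (cases "T = T'")
    case True
    then show ?thesis using wf_not_refl[OF wf_lex_less] by (auto simp: violet_less_def)
  next
    case False
    then obtain k where k: "first_difference T T' k" using first_difference_neq T T' by blast
    note vl = violet_less_iff[OF T T' k]
    show ?thesis
    proof (cases "snd (flag T k) \<in> T'")
      case True
      then show ?thesis using lex[OF J J' k] vl by blast
    next
      case False
      have "(T', T) \<in> lex_less"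
        using lex[OF J' J first_difference_sym[OF k]] False k by (auto simp: first_difference_def)
      then have "(T, T') \<notin> lex_less" by (rule wf_not_sym[OF wf_lex_less])
      then show ?thesis using vl False by blast
    qed
  qed
qed

lemma violet_less_total:
  assumes "T \<in> V_cut_Jaeger_trees G r b0 \<beta>" "T' \<in> V_cut_Jaeger_trees G r b0 \<beta>" "T \<noteq> T'"
  shows "violet_less r b0 \<beta> T T' \<or> violet_less r b0 \<beta> T' T"
proof -
  note T = jaegerD(1)[OF assms(1)] and T' = jaegerD(1)[OF assms(2)]
  obtain k where k: "first_difference T T' k" using first_difference_neq[OF T T' assms(3)] by blast
  then have "flag T k = flag T' k" "snd (flag T k) \<in> T \<or> snd (flag T k) \<in> T'"
    by (auto simp: first_difference_def)
  then show ?thesis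
    using violet_less_iff[OF T T' k] violet_less_iff[OF T' T first_difference_sym[OF k]] by auto
qed

text \<open>The separating edge is met in \<open>T\<close> first at its end in V, so the base node
  is outside its shore. Another edge of the same direction is not in \<open>T\<close>, and its end
  in V is visited before time \<open>k\<close>. Up to then both trees make the same decisions, so it
  is not in \<open>T'\<close> either.\<close>

lemma violet_less_cut:
  assumes J': "T' \<in> V_cut_Jaeger_trees G r b0 \<beta>" and J: "T \<in> V_cut_Jaeger_trees G r b0 \<beta>"
    and less: "violet_less r b0 \<beta> T' T"
  obtains e v where "(e, v) \<in> T" "b0 \<notin> shore T (e, v)"
    "\<And>e' v'. (e', v') \<in> T' \<Longrightarrow> Inl e' \<in> shore T (e, v) \<Longrightarrow> Inr v' \<in> shore T (e, v)"
proof -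
  note T = jaegerD(1)[OF J] and T' = jaegerD(1)[OF J']
  have "T' \<noteq> T" using less by (simp add: violet_less_def)
  then obtain k where k: "first_difference T' T k" using first_difference_neq T T' by blast
  then have "snd (flag T' k) \<in> T" using less violet_less_iff[OF T' T k] by blast
  then obtain e v where ev: "flag T' k = (Inr v, (e, v))" "(e, v) \<in> T" "(e, v) \<notin> T'"
    and pos: "pos T (Inr v, (e, v)) = k" "k < pos T (Inl e, (e, v))"
    using jaeger_first_difference[OF J' J k] by blast
  have b0: "b0 \<notin> shore T (e, v)"
    using shore_interval'(1)[OF T ev(2)] pos by force
  note iv = shore_interval[OF T ev(2) b0]
  have "Inr v' \<in> shore T (e, v)" if e'v': "(e', v') \<in> T'" "Inl e' \<in> shore T (e, v)" for e' v'
  proof (rule ccontr)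
    assume v': "Inr v' \<notin> shore T (e, v)"
    have ne: "(e', v') \<noteq> (e, v)" using ev(3) e'v'(1) by auto
    have G: "(e', v') \<in> G" using e'v'(1) jaegerD(2)[OF J'] by blast
    have nT: "(e', v') \<notin> T" using shore_edge[of e' v' T "(e, v)"] ne e'v'(2) v' by blast
    then have "pos T (Inr v', (e', v')) < pos T (Inl e', (e', v'))"
      using J G by (simp add: jaeger_iff)
    moreover have "pos T (Inr v', (e', v')) \<noteq> k"
      using flag_pos[OF T, of "(Inr v', (e', v'))"] flag_pos[OF T, of "(Inr v, (e, v))"] pos(1) G ne
        ev(2) jaegerD(2)[OF J] by auto
    ultimately have lt: "pos T (Inr v', (e', v')) < k"
      using iv(2)[of "(Inr v', (e', v'))"] iv(2)[of "(Inl e', (e', v'))"] pos G e'v'(2) v' by auto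
    then have "snd (flag T' (pos T (Inr v', (e', v')))) \<in> T' \<longleftrightarrow>
        snd (flag T' (pos T (Inr v', (e', v')))) \<in> T"
      and "flag T' (pos T (Inr v', (e', v'))) = flag T (pos T (Inr v', (e', v')))"
      using k by (auto simp: first_difference_def)
    then show False using flag_pos[OF T, of "(Inr v', (e', v'))"] G nT e'v'(1) by simp
  qed
  then show ?thesis using that ev(2) b0 by blast
qed

text \<open>The first difference is at \<open>(e, v)\<close> in E, where the new tree traverses, or
  at \<epsilon> in V, where the new tree skips; both decisions are \<open>False\<close>. It cannot
  be at \<epsilon> in E: then the complement of the shore would be visited in one interval after
  time \<open>k\<close>. As this interval contains the visit of \<open>(e, v)\<close> at
  \<open>Inr v\<close> but not the earlier one at \<open>Inl e\<close>, the latter would precede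
  \<open>k\<close>.\<close>

lemma exchange_lex_less:
  assumes T: "spanning_tree G T" and T': "spanning_tree G (insert (e, v) (T - {\<epsilon>}))"
    and ev: "(e, v) \<in> G - T" "pos T (Inl e, (e, v)) < pos T (Inr v, (e, v))"
    and \<epsilon>: "\<epsilon> \<in> T" "Inl e \<in> shore T \<epsilon>" "Inr v \<notin> shore T \<epsilon>"
  shows "(insert (e, v) (T - {\<epsilon>}), T) \<in> lex_less"
proof -
  obtain e1 v1 where [simp]: "\<epsilon> = (e1, v1)" by (cases \<epsilon>)
  let ?T' = "insert (e, v) (T - {\<epsilon>})"
  have G: "(e1, v1) \<in> G" "(e, v) \<in> G" using T \<epsilon>(1) ev(1) by (auto simp: spanning_tree_iff)
  have diff: "\<delta> \<in> T \<longleftrightarrow> \<delta> \<notin> ?T' \<Longrightarrow> \<delta> = (e, v) \<or> \<delta> = \<epsilon>" for \<delta> by auto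
  obtain k where k: "first_difference T ?T' k" "k \<le> pos T (Inl e, (e, v))"
    using first_difference_exists[OF T T', of "(Inl e, (e, v))"] G ev(1) by auto
  have kN: "k < card (flags G)" using k(1) by (simp add: first_difference_def)
  obtain x \<delta> where f: "flag T k = (x, \<delta>)" by (cases "flag T k")
  have \<delta>: "\<delta> = (e, v) \<or> \<delta> = \<epsilon>" using k(1) f by (intro diff) (simp add: first_difference_def)
  have pos_k: "pos T (x, \<delta>) = k" using pos_flag[OF T kN] f by simp
  have fl: "(x, \<delta>) \<in> flags G" using flag_in[of T k] f by simp
  have "isl x \<longleftrightarrow> \<delta> \<in> ?T'"
  proof (cases "\<delta> = (e, v)")
    case True
    then have "x = Inl e \<or> x = Inr v" using fl by (auto simp: flags_iff)
    then have "x = Inl e" using True pos_k k(2) ev(2) by auto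
    then show ?thesis using True by simp
  next
    case False
    then have \<delta>: "\<delta> = \<epsilon>" using \<delta> by blast
    then have x: "x = Inl e1 \<or> x = Inr v1" using fl by (auto simp: flags_iff)
    have "x \<noteq> Inl e1"
    proof
      assume "x = Inl e1"
      then have p: "pos T (Inl e1, \<epsilon>) = k" using pos_k \<delta> by simp
      \<comment> \<open>The first difference is unique, so the bound by the other flag of \<epsilon>
        shows that the flag in E is the earlier one.\<close>
      obtain k' where k': "first_difference T ?T' k'" "k' \<le> pos T (Inr v1, \<epsilon>)"
        using first_difference_exists[OF T T', of "(Inr v1, \<epsilon>)"] G \<epsilon>(1) ev(1) by auto
      have "k' = k"
        using k(1) k'(1) unfolding first_difference_def by (metis linorder_neqE_nat)
      then have "\<not> pos T (Inr v1, (e1, v1)) < pos T (Inl e1, (e1, v1))" using p k'(2) by simp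
      then have b0: "b0 \<in> shore T (e1, v1)" using shore_interval(1)[OF T, of e1 v1] \<epsilon>(1) by auto
      note iv = shore_interval'[OF T _ b0]
      have "pos T (Inl e, (e, v)) \<noteq> k"
        using flag_pos[OF T, of "(Inl e, (e, v))"] f False G by auto
      then show False
        using iv(2)[of "(Inl e, (e, v))"] iv(2)[of "(Inr v, (e, v))"] G \<epsilon> ev(2) k(2) p by auto
    qed
    then show ?thesis using x \<delta> False by auto
  qed
  then show ?thesis
    using lex_lessI[OF first_difference_sym[OF k(1)]] k(1) f by (auto simp: first_difference_def)
qed

end

section \<open>Root polytopes\<close>

definition edge_vector :: "('e::finite, 'v::finite) edge \<Rightarrow> (real ^ 'e) \<times> (real ^ 'v)" where
  "edge_vector \<epsilon> = node_vector (Inl (fst \<epsilon>)) + node_vector (Inr (snd \<epsilon>))"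

lemma edge_vector_eq: "edge_vector (e, v) = (axis e 1, axis v 1)"
  by (simp add: edge_vector_def)

lemma inj_edge_vector: "inj edge_vector"
  by (rule injI) (auto simp: edge_vector_eq axis_eq_axis split_paired_all)

lemma root_polytope_eq: "root_polytope H = convex hull (edge_vector ` H)"
proof -
  have "{node_vector (Inl e) + node_vector (Inr v) |e v. (e, v) \<in> H} = edge_vector ` H"
    by (force simp: edge_vector_def)
  then show ?thesis by (simp only: root_polytope_def)
qed

lemma sum_edge_vector_reindex:
  "(\<Sum>y\<in>edge_vector ` H. u y *\<^sub>R y) = (\<Sum>\<epsilon>\<in>H. u (edge_vector \<epsilon>) *\<^sub>R edge_vector \<epsilon>)"
  by (rule sum.reindex_cong[OF inj_on_subset[OF inj_edge_vector subset_UNIV]]) auto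

lemma mem_root_polytope:
  "p \<in> root_polytope H \<longleftrightarrow> (\<exists>x. (\<forall>\<epsilon>\<in>H. 0 \<le> x \<epsilon>) \<and> sum x H = 1 \<and> (\<Sum>\<epsilon>\<in>H. x \<epsilon> *\<^sub>R edge_vector \<epsilon>) = p)"
proof -
  have inj: "inj_on edge_vector H" using inj_edge_vector by (rule inj_on_subset) simp
  have hull: "p \<in> root_polytope H \<longleftrightarrow> (\<exists>u. (\<forall>y\<in>edge_vector ` H. 0 \<le> u y) \<and>
      sum u (edge_vector ` H) = 1 \<and> (\<Sum>y\<in>edge_vector ` H. u y *\<^sub>R y) = p)"
    by (simp add: root_polytope_eq convex_hull_finite)
  show ?thesis
  proof
    assume "p \<in> root_polytope H"
    then obtain u where "\<forall>y\<in>edge_vector ` H. 0 \<le> u y" "sum u (edge_vector ` H) = 1"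
      "(\<Sum>y\<in>edge_vector ` H. u y *\<^sub>R y) = p" unfolding hull by blast
    then show "\<exists>x. (\<forall>\<epsilon>\<in>H. 0 \<le> x \<epsilon>) \<and> sum x H = 1 \<and> (\<Sum>\<epsilon>\<in>H. x \<epsilon> *\<^sub>R edge_vector \<epsilon>) = p"
      by (intro exI[of _ "u \<circ> edge_vector"]) (simp add: sum_edge_vector_reindex sum.reindex[OF inj])
  next
    assume "\<exists>x. (\<forall>\<epsilon>\<in>H. 0 \<le> x \<epsilon>) \<and> sum x H = 1 \<and> (\<Sum>\<epsilon>\<in>H. x \<epsilon> *\<^sub>R edge_vector \<epsilon>) = p"
    then obtain x where "\<forall>\<epsilon>\<in>H. 0 \<le> x \<epsilon>" "sum x H = 1" "(\<Sum>\<epsilon>\<in>H. x \<epsilon> *\<^sub>R edge_vector \<epsilon>) = p"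
      by blast
    then show "p \<in> root_polytope H"
      unfolding hull
      by (intro exI[of _ "x \<circ> inv edge_vector"])
        (simp add: sum_edge_vector_reindex sum.reindex[OF inj] inv_f_f[OF inj_edge_vector])
  qed
qed

lemma convex_root_polytope: "convex (root_polytope H)"
  by (simp add: root_polytope_eq)

lemma closed_root_polytope: "closed (root_polytope H)"
  by (simp add: root_polytope_eq compact_imp_closed finite_imp_compact_convex_hull)

lemma edge_vector_in: "\<epsilon> \<in> H \<Longrightarrow> edge_vector \<epsilon> \<in> root_polytope H"
  by (simp add: root_polytope_eq hull_inc)

lemma root_polytope_mono: "H \<subseteq> K \<Longrightarrow> root_polytope H \<subseteq> root_polytope K"
  by (simp add: root_polytope_eq hull_mono image_mono)

section \<open>Cut functionals and linear relations between edge vectors\<close>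

definition cut_value :: "('e, 'v) node set \<Rightarrow> (real ^ 'e) \<times> (real ^ 'v) \<Rightarrow> real" where
  "cut_value A p = (\<Sum>e | Inl e \<in> A. fst p $ e) - (\<Sum>v | Inr v \<in> A. snd p $ v)"

lemma linear_cut_value: "linear (cut_value A)"
  by (rule linearI)
    (simp_all add: cut_value_def sum.distrib sum_distrib_left right_diff_distrib)

lemma cut_value_edge_vector:
  "cut_value A (edge_vector (e, v)) = of_bool (Inl e \<in> A) - of_bool (Inr v \<in> A)"
  by (simp add: cut_value_def edge_vector_eq axis_def of_bool_def)

lemma cut_value_sum:
  "cut_value A (\<Sum>\<epsilon>\<in>H. x \<epsilon> *\<^sub>R edge_vector \<epsilon>) = (\<Sum>\<epsilon>\<in>H. x \<epsilon> * cut_value A (edge_vector \<epsilon>))"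
  by (simp add: linear_sum[OF linear_cut_value] linear_scale[OF linear_cut_value])

text \<open>With all of E as node set the functional is 1 on every edge vector, so the coefficient
  sum depends only on the represented vector.\<close>

lemma sum_coefficients:
  fixes H :: "('e::finite \<times> 'v::finite) set"
  shows "cut_value (range Inl) (\<Sum>\<epsilon>\<in>H. x \<epsilon> *\<^sub>R edge_vector \<epsilon>) = sum x H"
proof -
  have "cut_value (range Inl) (edge_vector \<epsilon>) = 1" for \<epsilon> :: "'e \<times> 'v"
    by (cases \<epsilon>) (auto simp: cut_value_edge_vector)
  then show ?thesis by (simp add: cut_value_sum)
qed

lemma cut_value_le_0:
  assumes "p \<in> root_polytope H" "\<And>\<epsilon>. \<epsilon> \<in> H \<Longrightarrow> cut_value A (edge_vector \<epsilon>) \<le> 0"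
  shows "cut_value A p \<le> 0"
proof -
  obtain x where x: "\<forall>\<epsilon>\<in>H. 0 \<le> x \<epsilon>" "(\<Sum>\<epsilon>\<in>H. x \<epsilon> *\<^sub>R edge_vector \<epsilon>) = p"
    using assms(1) by (auto simp: mem_root_polytope)
  have "(\<Sum>\<epsilon>\<in>H. x \<epsilon> * cut_value A (edge_vector \<epsilon>)) \<le> 0"
    using x(1) assms(2) by (intro sum_nonpos mult_nonneg_nonpos) blast+
  then show ?thesis by (simp only: cut_value_sum flip: x(2))
qed

text \<open>Only \<epsilon> crosses its own cut within a forest, so the shore functionals are dual
  to the edge vectors of \<open>T\<close>.\<close>

lemma cut_value_shore:
  assumes "forest T" "\<epsilon> \<in> T" "\<delta> \<in> T"
  shows "cut_value (shore T \<epsilon>) (edge_vector \<delta>) = of_bool (\<delta> = \<epsilon>)"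
  using assms Inr_shore[of T "fst \<epsilon>" "snd \<epsilon>"] shore_edge[of "fst \<delta>" "snd \<delta>" T \<epsilon>]
    Inl_shore[of "fst \<epsilon>" T "snd \<epsilon>"]
  by (cases \<epsilon>; cases \<delta>) (auto simp: cut_value_edge_vector)

lemma coefficient_eq_cut_value:
  assumes "forest T" "\<epsilon> \<in> T" "S \<subseteq> T"
  shows "cut_value (shore T \<epsilon>) (\<Sum>\<delta>\<in>S. x \<delta> *\<^sub>R edge_vector \<delta>) = (if \<epsilon> \<in> S then x \<epsilon> else 0)"
proof -
  have "cut_value (shore T \<epsilon>) (\<Sum>\<delta>\<in>S. x \<delta> *\<^sub>R edge_vector \<delta>) = (\<Sum>\<delta>\<in>S. if \<delta> = \<epsilon> then x \<delta> else 0)"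
    unfolding cut_value_sum using assms by (intro sum.cong) (auto simp: cut_value_shore subset_iff)
  then show ?thesis by simp
qed

lemma independent_edge_vectors:
  assumes "forest T"
  shows "independent (edge_vector ` T)"
proof -
  have "u (edge_vector \<epsilon>) = 0" if "(\<Sum>y\<in>edge_vector ` T. u y *\<^sub>R y) = 0" "\<epsilon> \<in> T" for u \<epsilon>
    using coefficient_eq_cut_value[OF assms that(2) subset_refl, of "u \<circ> edge_vector"] that
    by (simp add: sum_edge_vector_reindex linear_0[OF linear_cut_value])
  then show ?thesis by (auto simp: dependent_finite)
qed

text \<open>With a sign for each color, edge vectors are differences of node vectors and telescope
  along a path.\<close>

lemma edge_vector_in_span:
  fixes H :: "('e::finite \<times> 'v::finite) set"
  assumes "connected_graph H"
  shows "edge_vector \<epsilon> \<in> span (edge_vector ` H)"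
proof -
  obtain e v where [simp]: "\<epsilon> = (e, v)" by (cases \<epsilon>)
  define s :: "'e + 'v \<Rightarrow> (real ^ 'e) \<times> (real ^ 'v)"
    where "s x = (if isl x then node_vector x else - node_vector x)" for x
  have edge: "edge_vector (e, v) = s (Inl e) - s (Inr v)" for e v
    by (simp add: s_def edge_vector_def)
  have "component H (Inl e) \<subseteq> {y. s (Inl e) - s y \<in> span (edge_vector ` H)}"
  proof (rule component_subsetI)
    fix y z assume y: "y \<in> {y. s (Inl e) - s y \<in> span (edge_vector ` H)}" and "(y, z) \<in> adjacent H"
    then have "s y - s z \<in> edge_vector ` H \<or> - (s y - s z) \<in> edge_vector ` H"
      by (cases y; cases z) (auto simp flip: edge)
    then have "s y - s z \<in> span (edge_vector ` H)"
      by (metis span_base span_neg minus_minus)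
    then show "z \<in> {y. s (Inl e) - s y \<in> span (edge_vector ` H)}"
      using span_add[of "s (Inl e) - s y" "edge_vector ` H" "s y - s z"] y by simp
  qed (simp add: span_zero)
  then show ?thesis using assms by (auto simp: edge connected_graph_def)
qed

lemma edge_vector_combination:
  assumes "connected_graph H"
  obtains u where "edge_vector \<epsilon> = (\<Sum>\<delta>\<in>H. u \<delta> *\<^sub>R edge_vector \<delta>)"
proof -
  have "edge_vector \<epsilon> \<in> span (edge_vector ` H)" by (rule edge_vector_in_span[OF assms])
  then obtain u where "edge_vector \<epsilon> = (\<Sum>y\<in>edge_vector ` H. u y *\<^sub>R y)"
    by (auto simp: span_finite)
  then show ?thesis using that[of "u \<circ> edge_vector"] by (simp add: sum_edge_vector_reindex)
qed

lemma edge_vector_expansion: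
  assumes "connected_graph T" "forest T"
  shows "edge_vector \<epsilon> = (\<Sum>\<delta>\<in>T. cut_value (shore T \<delta>) (edge_vector \<epsilon>) *\<^sub>R edge_vector \<delta>)"
proof -
  obtain u where u: "edge_vector \<epsilon> = (\<Sum>\<delta>\<in>T. u \<delta> *\<^sub>R edge_vector \<delta>)"
    by (rule edge_vector_combination[OF assms(1)])
  then have "cut_value (shore T \<delta>) (edge_vector \<epsilon>) = u \<delta>" if "\<delta> \<in> T" for \<delta>
    using coefficient_eq_cut_value[OF assms(2) that subset_refl, of u] that by simp
  then show ?thesis using u by (metis (no_types, lifting) sum.cong)
qed

lemma card_image_edge_vector: "card (edge_vector ` H) = card H"
  by (rule card_image[OF inj_on_subset[OF inj_edge_vector subset_UNIV]])

text \<open>Deleting a non-bridge of \<open>H\<close> would leave a spanning family smaller than the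
  independent family of \<open>T\<close>.\<close>

lemma forest_if_card_le:
  fixes H T :: "('e::finite \<times> 'v::finite) set"
  assumes H: "connected_graph H" "card H \<le> card T" and T: "forest T"
  shows "forest H"
  unfolding forest_def
proof safe
  fix e v assume ev: "(e, v) \<in> H" "Inr v \<in> component (H - {(e, v)}) (Inl e)"
  then have "connected_graph (H - {(e, v)})" by (intro connected_graph_remove H)
  then have "edge_vector ` T \<subseteq> span (edge_vector ` (H - {(e, v)}))"
    using edge_vector_in_span by blast
  then have "card (edge_vector ` T) \<le> card (edge_vector ` (H - {(e, v)}))"
    using independent_span_bound[of "edge_vector ` (H - {(e, v)})" "edge_vector ` T"]
      independent_edge_vectors[OF T] by simp
  then show False using ev(1) H(2) card_Diff1_less[of H "(e, v)"] by (simp add: card_image_edge_vector)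
qed

text \<open>Adding multiples of the relation \<open>c\<close> changes neither the point nor the
  coefficient sum. One stops when the first coefficient vanishes.\<close>

lemma root_polytope_push:
  fixes H :: "('e::finite \<times> 'v::finite) set"
  assumes p: "p \<in> root_polytope H" and c: "(\<Sum>\<epsilon>\<in>H. c \<epsilon> *\<^sub>R edge_vector \<epsilon>) = 0"
    and neg: "\<epsilon>' \<in> H" "c \<epsilon>' < 0"
  obtains \<epsilon> where "\<epsilon> \<in> H" "c \<epsilon> < 0" "p \<in> root_polytope (H - {\<epsilon>})"
proof -
  obtain x where x: "\<And>\<epsilon>. \<epsilon> \<in> H \<Longrightarrow> 0 \<le> x \<epsilon>" "sum x H = 1" "(\<Sum>\<epsilon>\<in>H. x \<epsilon> *\<^sub>R edge_vector \<epsilon>) = p"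
    using p by (auto simp: mem_root_polytope)
  let ?N = "{\<epsilon> \<in> H. c \<epsilon> < 0}"
  \<comment> \<open>The multiple of \<open>c\<close> at which the coefficient of an edge with
    negative \<open>c\<close> reaches zero; the smallest one is used.\<close>
  define q where "q \<epsilon> = x \<epsilon> / (- c \<epsilon>)" for \<epsilon>
  obtain \<epsilon> where \<epsilon>: "\<epsilon> \<in> ?N" "\<And>\<delta>. \<delta> \<in> ?N \<Longrightarrow> q \<epsilon> \<le> q \<delta>"
    using ex_is_arg_min_if_finite[of ?N q] neg finite[of ?N] unfolding is_arg_min_linorder by blast
  have t: "0 \<le> q \<epsilon>" using \<epsilon>(1) x(1) by (simp add: q_def divide_nonneg_neg)
  define y where "y \<delta> = x \<delta> + q \<epsilon> * c \<delta>" for \<delta>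
  have y0: "y \<epsilon> = 0" using \<epsilon>(1) by (simp add: y_def q_def)
  have y: "0 \<le> y \<delta>" if "\<delta> \<in> H" for \<delta>
  proof (cases "c \<delta> < 0")
    case True
    then have "q \<epsilon> \<le> x \<delta> / (- c \<delta>)" using \<epsilon>(2) that by (simp add: q_def)
    then have "q \<epsilon> * (- c \<delta>) \<le> x \<delta>" using True by (subst (asm) pos_le_divide_eq) auto
    then show ?thesis by (simp add: y_def)
  next
    case False
    then show ?thesis using x(1)[OF that] t by (simp add: y_def)
  qed
  have "sum c H = 0" using sum_coefficients[of c H] c by (simp add: linear_0[OF linear_cut_value])
  then have sum: "sum y H = 1"
    using x(2) by (simp add: y_def sum.distrib flip: sum_distrib_left)
  have "(\<Sum>\<delta>\<in>H. y \<delta> *\<^sub>R edge_vector \<delta>) =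
      (\<Sum>\<delta>\<in>H. x \<delta> *\<^sub>R edge_vector \<delta>) + q \<epsilon> *\<^sub>R (\<Sum>\<delta>\<in>H. c \<delta> *\<^sub>R edge_vector \<delta>)"
    by (simp add: y_def scaleR_left_distrib sum.distrib scaleR_sum_right)
  then have vec: "(\<Sum>\<delta>\<in>H. y \<delta> *\<^sub>R edge_vector \<delta>) = p" using x(3) c by simp
  have "\<epsilon> \<in> H" using \<epsilon>(1) by simp
  then have "p \<in> root_polytope (H - {\<epsilon>})"
    unfolding mem_root_polytope using y sum vec y0 by (intro exI[of _ y]) (simp add: sum_diff1)
  moreover have "c \<epsilon> < 0" using \<epsilon>(1) by simp
  ultimately show ?thesis using that \<open>\<epsilon> \<in> H\<close> by blast
qed

text \<open>An edge that is not a bridge gives a linear relation, along which an edge can be pushed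
  out without disconnecting the graph.\<close>

lemma root_polytope_tree:
  fixes H :: "('e::finite \<times> 'v::finite) set"
  assumes "connected_graph H" "p \<in> root_polytope H"
  shows "\<exists>T \<subseteq> H. connected_graph T \<and> forest T \<and> p \<in> root_polytope T"
  using finite[of H] assms
proof (induction H rule: finite_psubset_induct)
  case (psubset H)
  show ?case
  proof (cases "forest H")
    case False
    then obtain e v where ev: "(e, v) \<in> H" "Inr v \<in> component (H - {(e, v)}) (Inl e)"
      by (auto simp: forest_def)
    let ?K = "H - {(e, v)}"
    have "connected_graph ?K" using connected_graph_remove[OF psubset.prems(1) ev(2)] .
    then obtain u where u: "edge_vector (e, v) = (\<Sum>\<delta>\<in>?K. u \<delta> *\<^sub>R edge_vector \<delta>)"
      by (rule edge_vector_combination)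
    \<comment> \<open>The value \<open>-1\<close> makes this a relation and provides a negative
      coefficient.\<close>
    define c where "c = u((e, v) := -1)"
    have "(\<Sum>\<delta>\<in>H. c \<delta> *\<^sub>R edge_vector \<delta>) = c (e, v) *\<^sub>R edge_vector (e, v) + (\<Sum>\<delta>\<in>?K. c \<delta> *\<^sub>R edge_vector \<delta>)"
      using ev(1) by (simp add: sum.remove)
    also have "(\<Sum>\<delta>\<in>?K. c \<delta> *\<^sub>R edge_vector \<delta>) = edge_vector (e, v)"
      unfolding u by (rule sum.cong) (auto simp: c_def)
    finally have c: "(\<Sum>\<delta>\<in>H. c \<delta> *\<^sub>R edge_vector \<delta>) = 0" by (simp add: c_def)
    obtain \<epsilon> where \<epsilon>: "\<epsilon> \<in> H" "c \<epsilon> < 0" "p \<in> root_polytope (H - {\<epsilon>})"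
      by (rule root_polytope_push[OF psubset.prems(2) c ev(1)]) (simp_all add: c_def)
    obtain e' v' where [simp]: "\<epsilon> = (e', v')" by (cases \<epsilon>)
    \<comment> \<open>If \<epsilon> were a bridge, its cut functional would single out
      \<open>c \<epsilon>\<close> in the relation and force it to be zero.\<close>
    have "Inr v' \<in> component (H - {\<epsilon>}) (Inl e')"
    proof (rule ccontr)
      let ?A = "component (H - {\<epsilon>}) (Inl e')"
      assume v': "Inr v' \<notin> ?A"
      have "cut_value ?A (edge_vector \<delta>) = of_bool (\<delta> = \<epsilon>)" if "\<delta> \<in> H" for \<delta>
        using v' that component_edge[of "fst \<delta>" "snd \<delta>" "H - {\<epsilon>}" "Inl e'"]
        by (cases \<delta>) (auto simp: cut_value_edge_vector)
      then have "(\<Sum>\<delta>\<in>H. c \<delta> * cut_value ?A (edge_vector \<delta>)) = (\<Sum>\<delta>\<in>H. if \<delta> = \<epsilon> then c \<delta> else 0)"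
        by (intro sum.cong) auto
      also have "\<dots> = c \<epsilon>" using \<epsilon>(1) by simp
      finally have "cut_value ?A 0 = c \<epsilon>" by (simp only: c flip: cut_value_sum)
      then show False using \<epsilon>(2) by (simp add: linear_0[OF linear_cut_value])
    qed
    then have "connected_graph (H - {\<epsilon>})" using connected_graph_remove[OF psubset.prems(1)] by simp
    then have "\<exists>T \<subseteq> H - {\<epsilon>}. connected_graph T \<and> forest T \<and> p \<in> root_polytope T"
      using \<epsilon>(1,3) by (intro psubset.IH) auto
    then show ?thesis by blast
  qed (use psubset.prems in blast)
qed

text \<open>
  Pushing the coefficients of a point along the cycle of \<open>T + (e, v)\<close>, with the coefficient of
  \<open>(e, v)\<close> increasing, until some coefficient vanishes.
\<close>

lemma root_polytope_exchange:
  fixes T :: "('e::finite \<times> 'v::finite) set"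
  assumes T: "connected_graph T" "forest T" and p: "p \<in> root_polytope T" and ev: "(e, v) \<notin> T"
  obtains \<epsilon> where "\<epsilon> \<in> T" "Inl e \<in> shore T \<epsilon>" "Inr v \<notin> shore T \<epsilon>"
    "connected_graph (insert (e, v) (T - {\<epsilon>}))" "forest (insert (e, v) (T - {\<epsilon>}))"
    "p \<in> root_polytope (insert (e, v) (T - {\<epsilon>}))"
proof -
  let ?g = "(e, v)" and ?H = "insert (e, v) T"
  \<comment> \<open>The new edge minus its expansion in \<open>T\<close>: a tree edge gets a
    negative coefficient iff the new edge crosses its cut in the same direction.\<close>
  define c where "c \<delta> = (if \<delta> = ?g then 1 else - cut_value (shore T \<delta>) (edge_vector ?g))" for \<delta>
  have "(\<Sum>\<delta>\<in>T. c \<delta> *\<^sub>R edge_vector \<delta>) =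
      - (\<Sum>\<delta>\<in>T. cut_value (shore T \<delta>) (edge_vector ?g) *\<^sub>R edge_vector \<delta>)"
    unfolding sum_negf[symmetric] using ev by (intro sum.cong) (auto simp: c_def)
  also have "\<dots> = - edge_vector ?g" using edge_vector_expansion[OF T] by simp
  finally have cT: "(\<Sum>\<delta>\<in>T. c \<delta> *\<^sub>R edge_vector \<delta>) = - edge_vector ?g" .
  then have c: "(\<Sum>\<delta>\<in>?H. c \<delta> *\<^sub>R edge_vector \<delta>) = 0"
    using ev by (simp add: c_def)
  have "sum c ?H = 0" using sum_coefficients[of c ?H] c by (simp add: linear_0[OF linear_cut_value])
  \<comment> \<open>A relation has coefficient sum zero, and the new edge contributes
    \<open>1\<close>.\<close>
  then have "sum c T < 0" using ev by (simp add: c_def)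
  then obtain \<delta> where "\<delta> \<in> T" "c \<delta> < 0" by (metis not_le sum_nonneg)
  moreover have "p \<in> root_polytope ?H" using p root_polytope_mono[of T ?H] by blast
  ultimately obtain \<epsilon> where \<epsilon>: "\<epsilon> \<in> ?H" "c \<epsilon> < 0" "p \<in> root_polytope (?H - {\<epsilon>})"
    using root_polytope_push[OF _ c] by blast
  then have ne: "\<epsilon> \<noteq> ?g" by (auto simp: c_def)
  then have \<epsilon>T: "\<epsilon> \<in> T" using \<epsilon>(1) by blast
  have eq: "?H - {\<epsilon>} = insert ?g (T - {\<epsilon>})" using ne by auto
  have shore: "Inl e \<in> shore T \<epsilon>" "Inr v \<notin> shore T \<epsilon>"
    using \<epsilon>(2) ne by (auto simp: c_def cut_value_edge_vector of_bool_def split: if_splits)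
  have conn: "connected_graph (insert ?g (T - {\<epsilon>}))"
    using shore by (intro connected_graph_exchange[OF T \<epsilon>T]) auto
  have "card (insert ?g (T - {\<epsilon>})) \<le> card T"
    using \<epsilon>T ev card_Suc_Diff1[OF finite \<epsilon>T] by simp
  then have "forest (insert ?g (T - {\<epsilon>}))" using forest_if_card_le[OF conn _ T(2)] by blast
  then show ?thesis using that[OF \<epsilon>T shore conn] \<epsilon>(3) eq by simp
qed

section \<open>The simplices of spanning trees and their facets\<close>

lemma not_affine_dependent_edge_vectors: "forest T \<Longrightarrow> \<not> affine_dependent (edge_vector ` T)"
  using independent_edge_vectors affine_dependent_imp_dependent by blast

text \<open>Every edge vector is an affine combination of those of \<open>T\<close>: the
  coefficients of its expansion sum to 1 because the functional of all of E is 1 on both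
  sides.\<close>

lemma simplex_root_polytope:
  assumes "connected_graph T" "forest T" "T \<subseteq> G"
  shows "aff_dim (root_polytope G) simplex (root_polytope T)"
proof -
  have "edge_vector \<epsilon> \<in> affine hull (edge_vector ` T)" for \<epsilon>
  proof -
    define u where "u \<delta> = cut_value (shore T \<delta>) (edge_vector \<epsilon>)" for \<delta>
    have u: "(\<Sum>\<delta>\<in>T. u \<delta> *\<^sub>R edge_vector \<delta>) = edge_vector \<epsilon>"
      using edge_vector_expansion[OF assms(1,2), of \<epsilon>] by (simp add: u_def)
    have "sum u T = 1"
      using sum_coefficients[of u T] sum_coefficients[of "\<lambda>_. 1" "{\<epsilon>}"] by (simp add: u)
    then show ?thesis
      unfolding affine_hull_finite[OF finite_imageI[OF finite[of T]]] mem_Collect_eq using u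
      by (intro exI[of _ "u \<circ> inv edge_vector"])
        (simp add: sum_edge_vector_reindex inv_f_f[OF inj_edge_vector]
          sum.reindex[OF inj_on_subset[OF inj_edge_vector subset_UNIV]])
  qed
  then have "affine hull (edge_vector ` G) \<subseteq> affine hull (edge_vector ` T)"
    by (intro hull_minimal) auto
  moreover have "affine hull (edge_vector ` T) \<subseteq> affine hull (edge_vector ` G)"
    using assms(3) by (intro hull_mono image_mono)
  ultimately have "aff_dim (edge_vector ` G) = aff_dim (edge_vector ` T)"
    by (intro aff_dim_affine_hull2) auto
  then have "aff_dim (root_polytope G) = aff_dim (edge_vector ` T)"
    by (simp add: root_polytope_eq aff_dim_convex_hull)
  then show ?thesis
    unfolding simplex_def
    using not_affine_dependent_edge_vectors[OF assms(2)] aff_dim_affine_independent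
    by (intro exI[of _ "edge_vector ` T"]) (auto simp: root_polytope_eq)
qed

lemma facet_of_root_polytope:
  assumes "forest T"
  shows "F facet_of root_polytope T \<longleftrightarrow> (\<exists>\<epsilon>\<in>T. T - {\<epsilon>} \<noteq> {} \<and> F = root_polytope (T - {\<epsilon>}))"
proof -
  have "edge_vector ` T - {edge_vector \<epsilon>} = edge_vector ` (T - {\<epsilon>})" if "\<epsilon> \<in> T" for \<epsilon>
    using image_set_diff[OF inj_edge_vector, of T "{\<epsilon>}"] by simp
  then have "F facet_of root_polytope T \<longleftrightarrow> F \<noteq> {} \<and> (\<exists>\<epsilon>\<in>T. F = root_polytope (T - {\<epsilon>}))"
    unfolding root_polytope_eq facet_of_convex_hull_affine_independent[OF not_affine_dependent_edge_vectors[OF assms]]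
    by auto
  moreover have "root_polytope (T - {\<epsilon>}) \<noteq> {} \<longleftrightarrow> T - {\<epsilon>} \<noteq> {}" for \<epsilon>
    by (simp add: root_polytope_eq del: Diff_eq_empty_iff)
  ultimately show ?thesis by blast
qed

lemma cut_value_root_polytope_nonneg:
  assumes "forest T" "\<epsilon> \<in> T" "p \<in> root_polytope T"
  shows "0 \<le> cut_value (shore T \<epsilon>) p"
  using assms coefficient_eq_cut_value[OF assms(1,2) subset_refl] unfolding mem_root_polytope by force

lemma cut_value_root_polytope_0:
  assumes "forest T" "\<epsilon> \<in> T" "p \<in> root_polytope (T - {\<epsilon>})"
  shows "cut_value (shore T \<epsilon>) p = 0"
  using assms(3) coefficient_eq_cut_value[OF assms(1,2), of "T - {\<epsilon>}"] unfolding mem_root_polytope by force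

lemma root_polytope_facetI:
  assumes "forest T" "\<epsilon> \<in> T" "p \<in> root_polytope T" "cut_value (shore T \<epsilon>) p \<le> 0"
  shows "p \<in> root_polytope (T - {\<epsilon>})"
proof -
  obtain x where x: "\<forall>\<epsilon>\<in>T. 0 \<le> x \<epsilon>" "sum x T = 1" "(\<Sum>\<epsilon>\<in>T. x \<epsilon> *\<^sub>R edge_vector \<epsilon>) = p"
    using assms(3) by (auto simp: mem_root_polytope)
  have "x \<epsilon> = 0"
    using coefficient_eq_cut_value[OF assms(1,2) subset_refl, of x] x assms(2,4) by force
  then show ?thesis
    unfolding mem_root_polytope using x assms(2) by (intro exI[of _ x]) (simp add: sum_diff1)
qed

lemma cut_value_rel_interior:
  assumes "forest T" "\<epsilon> \<in> T" "p \<in> rel_interior (root_polytope T)"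
  shows "0 < cut_value (shore T \<epsilon>) p"
proof -
  obtain u where "\<forall>y\<in>edge_vector ` T. 0 < u y" "(\<Sum>y\<in>edge_vector ` T. u y *\<^sub>R y) = p"
    using assms(3)
    unfolding root_polytope_eq rel_interior_convex_hull_explicit[OF not_affine_dependent_edge_vectors[OF assms(1)]]
    by blast
  then show ?thesis
    using coefficient_eq_cut_value[OF assms(1,2) subset_refl, of "u \<circ> edge_vector"] assms(2)
    by (simp add: sum_edge_vector_reindex)
qed

text \<open>The barycenter of the vertices indexed by \<open>S\<close>.\<close>

lemma root_polytope_center:
  fixes T :: "('e::finite \<times> 'v::finite) set"
  assumes "forest T" "S \<subseteq> T" "S \<noteq> {}"
  obtains c where "c \<in> root_polytope S" "\<And>\<delta>. \<delta> \<in> S \<Longrightarrow> 0 < cut_value (shore T \<delta>) c"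
proof -
  define x where "x \<delta> = 1 / real (card S)" for \<delta> :: "'e \<times> 'v"
  have pos: "0 < x \<delta>" for \<delta> using assms(3) by (simp add: x_def card_gt_0_iff)
  have "sum x S = 1" using assms(3) by (simp add: x_def)
  then have "(\<Sum>\<delta>\<in>S. x \<delta> *\<^sub>R edge_vector \<delta>) \<in> root_polytope S"
    unfolding mem_root_polytope using pos by (intro exI[of _ x]) (auto intro: less_imp_le)
  moreover have "0 < cut_value (shore T \<delta>) (\<Sum>\<delta>\<in>S. x \<delta> *\<^sub>R edge_vector \<delta>)" if "\<delta> \<in> S" for \<delta>
    using coefficient_eq_cut_value[OF assms(1) _ assms(2), of \<delta> x] assms(2) that pos[of \<delta>] by auto
  ultimately show ?thesis using that by blast
qed

lemma closed_segment_start: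
  fixes a b :: "'a::euclidean_space"
  assumes "closed U" "\<And>s. 0 < s \<Longrightarrow> s \<le> 1 \<Longrightarrow> (1 - s) *\<^sub>R a + s *\<^sub>R b \<in> U"
  shows "a \<in> U"
proof (cases "a = b")
  case True
  then show ?thesis using assms(2)[of 1] by simp
next
  case False
  have "open_segment a b \<subseteq> U" using assms(2) by (auto simp: in_segment)
  then have "closure (open_segment a b) \<subseteq> U" using assms(1) by (rule closure_minimal)
  then show ?thesis using False by auto
qed

section \<open>Dissection and shelling\<close>

context ribbon_graph begin

text \<open>A tree minimal for \<open>lex_less\<close> among those whose simplex contains
  \<open>p\<close> admits no improving exchange, so it cuts no edge in E.\<close>

lemma jaeger_cover:
  assumes p: "p \<in> root_polytope G"
  shows "\<exists>T \<in> V_cut_Jaeger_trees G r b0 \<beta>. p \<in> root_polytope T"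
proof -
  let ?M = "{T. spanning_tree G T \<and> p \<in> root_polytope T}"
  have "?M \<noteq> {}" using root_polytope_tree[OF connected p] by (auto simp: spanning_tree_iff)
  then obtain T where T: "T \<in> ?M" and min: "\<And>T'. (T', T) \<in> lex_less \<Longrightarrow> T' \<notin> ?M"
    using wfE_min'[OF wf_lex_less, of ?M] by blast
  have tree: "spanning_tree G T" "T \<subseteq> G" "connected_graph T" "forest T" "p \<in> root_polytope T"
    using T by (simp_all add: spanning_tree_iff)
  have "pos T (Inr v, (e, v)) < pos T (Inl e, (e, v))" if ev: "(e, v) \<in> G - T" for e v
  proof (rule ccontr)
    assume "\<not> pos T (Inr v, (e, v)) < pos T (Inl e, (e, v))"
    moreover have "pos T (Inr v, (e, v)) \<noteq> pos T (Inl e, (e, v))"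
      using flag_pos[OF tree(1), of "(Inr v, (e, v))"] flag_pos[OF tree(1), of "(Inl e, (e, v))"] ev
      by auto
    ultimately have less: "pos T (Inl e, (e, v)) < pos T (Inr v, (e, v))" by simp
    have "(e, v) \<notin> T" using ev by blast
    then obtain \<epsilon> where \<epsilon>: "\<epsilon> \<in> T" "Inl e \<in> shore T \<epsilon>" "Inr v \<notin> shore T \<epsilon>"
      "connected_graph (insert (e, v) (T - {\<epsilon>}))" "forest (insert (e, v) (T - {\<epsilon>}))"
      "p \<in> root_polytope (insert (e, v) (T - {\<epsilon>}))"
      by (rule root_polytope_exchange[OF tree(3-5)])
    have tree': "spanning_tree G (insert (e, v) (T - {\<epsilon>}))"
      using \<epsilon>(4,5) ev tree(2) by (auto simp: spanning_tree_iff)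
    then have "(insert (e, v) (T - {\<epsilon>}), T) \<in> lex_less"
      using exchange_lex_less[OF tree(1) _ ev less \<epsilon>(1-3)] by blast
    then show False using min tree' \<epsilon>(6) by blast
  qed
  then show ?thesis using tree by (auto simp: jaeger_iff)
qed

text \<open>By connectivity \<open>T'\<close> has an edge across the cut, and this edge must have
  the opposite direction; so \<epsilon> is semi-passive.\<close>

lemma preceding_separated:
  assumes J': "T' \<in> V_cut_Jaeger_trees G r b0 \<beta>" and J: "T \<in> V_cut_Jaeger_trees G r b0 \<beta>"
    and less: "violet_less r b0 \<beta> T' T"
  obtains \<epsilon> where "\<epsilon> \<in> T" "b0 \<notin> shore T \<epsilon>"
    "internally_semi_passive G (emerald_less r b0 \<beta> T) T \<epsilon>"
    "\<And>\<delta>. \<delta> \<in> T' \<Longrightarrow> cut_value (shore T \<epsilon>) (edge_vector \<delta>) \<le> 0"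
proof -
  obtain e v where ev: "(e, v) \<in> T" "b0 \<notin> shore T (e, v)"
    and cut: "\<And>e' v'. (e', v') \<in> T' \<Longrightarrow> Inl e' \<in> shore T (e, v) \<Longrightarrow> Inr v' \<in> shore T (e, v)"
    using violet_less_cut[OF J' J less] by blast
  have "\<exists>e' v'. (e', v') \<in> T' \<and> Inl e' \<notin> shore T (e, v) \<and> Inr v' \<in> shore T (e, v)"
  proof (rule ccontr)
    assume "\<not> ?thesis"
    then have same: "Inl e' \<in> shore T (e, v) \<longleftrightarrow> Inr v' \<in> shore T (e, v)" if "(e', v') \<in> T'" for e' v'
      using cut that by blast
    have "component T' (Inl e) \<subseteq> shore T (e, v)"
    proof (rule component_subsetI)
      fix y z assume "y \<in> shore T (e, v)" "(y, z) \<in> adjacent T'"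
      then show "z \<in> shore T (e, v)" using same by (cases y; cases z) auto
    qed simp
    then show False
      using jaegerD(3)[OF J'] Inr_shore[OF jaegerD(4)[OF J] ev(1)] by (auto simp: connected_graph_def)
  qed
  then have "internally_semi_passive G (emerald_less r b0 \<beta> T) T (e, v)"
    using semi_passive_iff[OF J ev(1)] ev(2) jaegerD(2)[OF J'] by blast
  moreover have "cut_value (shore T (e, v)) (edge_vector \<delta>) \<le> 0" if "\<delta> \<in> T'" for \<delta>
    using cut that by (cases \<delta>) (auto simp: cut_value_edge_vector)
  ultimately show ?thesis using that ev by blast
qed

section \<open>Facets in the union of the preceding simplices\<close>

definition preceding :: "('e \<times> 'v) set \<Rightarrow> ((real ^ 'e) \<times> (real ^ 'v)) set" where
  "preceding T = \<Union>{root_polytope T' |T'. T' \<in> V_cut_Jaeger_trees G r b0 \<beta> \<and> violet_less r b0 \<beta> T' T}"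

definition semi_passive :: "('e \<times> 'v) set \<Rightarrow> ('e \<times> 'v) set" where
  "semi_passive T = {\<epsilon> \<in> T. internally_semi_passive G (emerald_less r b0 \<beta> T) T \<epsilon>}"

lemma facet_if_preceding:
  assumes J: "T \<in> V_cut_Jaeger_trees G r b0 \<beta>" and p: "p \<in> root_polytope T" "p \<in> preceding T"
  shows "\<exists>\<epsilon> \<in> semi_passive T. p \<in> root_polytope (T - {\<epsilon>})"
proof -
  obtain T' where T': "T' \<in> V_cut_Jaeger_trees G r b0 \<beta>" "violet_less r b0 \<beta> T' T" "p \<in> root_polytope T'"
    using p(2) by (auto simp: preceding_def)
  obtain \<epsilon> where \<epsilon>: "\<epsilon> \<in> T" "internally_semi_passive G (emerald_less r b0 \<beta> T) T \<epsilon>"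
    "\<And>\<delta>. \<delta> \<in> T' \<Longrightarrow> cut_value (shore T \<epsilon>) (edge_vector \<delta>) \<le> 0"
    using preceding_separated[OF T'(1) J T'(2)] by blast
  have "p \<in> root_polytope (T - {\<epsilon>})"
    using root_polytope_facetI[OF jaegerD(4)[OF J] \<epsilon>(1) p(1) cut_value_le_0[OF T'(3) \<epsilon>(3)]] .
  moreover have "\<epsilon> \<in> semi_passive T" using \<epsilon>(1,2) by (simp add: semi_passive_def)
  ultimately show ?thesis by blast
qed

lemma rel_interior_Int_preceding:
  assumes "T \<in> V_cut_Jaeger_trees G r b0 \<beta>" "T' \<in> V_cut_Jaeger_trees G r b0 \<beta>"
    and "violet_less r b0 \<beta> T' T"
  shows "rel_interior (root_polytope T) \<inter> root_polytope T' = {}"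
proof -
  obtain \<epsilon> where \<epsilon>: "\<epsilon> \<in> T" "\<And>\<delta>. \<delta> \<in> T' \<Longrightarrow> cut_value (shore T \<epsilon>) (edge_vector \<delta>) \<le> 0"
    using preceding_separated[OF assms(2,1,3)] by blast
  then show ?thesis
    using cut_value_rel_interior[OF jaegerD(4)[OF assms(1)] \<epsilon>(1)] cut_value_le_0[of _ T']
    by (meson disjoint_iff not_le)
qed

text \<open>If \<epsilon> were the only edge, its shore would contain no node in V, hence no end of
  an opposite edge. The empty face is thereby excluded as a facet.\<close>

lemma semi_passive_Diff_nonempty:
  assumes J: "T \<in> V_cut_Jaeger_trees G r b0 \<beta>" and \<epsilon>: "\<epsilon> \<in> semi_passive T"
  shows "T - {\<epsilon>} \<noteq> {}"
proof
  assume T: "T - {\<epsilon>} = {}"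
  obtain e v where [simp]: "\<epsilon> = (e, v)" by (cases \<epsilon>)
  have "T - {(e, v)} = {}" using T by simp
  then have "shore T (e, v) = {Inl e}" by (simp only: shore_def component_empty fst_conv)
  then show False using \<epsilon> semi_passive_iff[OF J, of e v] by (auto simp: semi_passive_def)
qed

text \<open>
  A point of the relative interior of the facet is moved across it, towards an edge of the cut with the
  opposite direction. It enters some Jaeger simplex, which cannot come later in the violet order, since
  its separating cut would have to be the cut of \<open>\<epsilon>\<close>, traversed in the wrong direction.
\<close>

lemma semi_passive_facet_interior:
  assumes J: "T \<in> V_cut_Jaeger_trees G r b0 \<beta>" and \<epsilon>: "\<epsilon> \<in> semi_passive T"
    and p: "p \<in> root_polytope (T - {\<epsilon>})" "\<And>\<delta>. \<delta> \<in> T - {\<epsilon>} \<Longrightarrow> 0 < cut_value (shore T \<delta>) p"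
  shows "p \<in> preceding T"
proof -
  let ?J = "V_cut_Jaeger_trees G r b0 \<beta>"
  obtain e v where ev [simp]: "\<epsilon> = (e, v)" by (cases \<epsilon>)
  have evT: "(e, v) \<in> T" using \<epsilon> by (simp add: semi_passive_def)
  let ?A = "shore T (e, v)"
  obtain e' v' where b0: "b0 \<notin> ?A" and g: "(e', v') \<in> G" "Inl e' \<notin> ?A" "Inr v' \<in> ?A"
    using \<epsilon> semi_passive_iff[OF J evT] by (auto simp: semi_passive_def)
  let ?W = "\<Union>(root_polytope ` (?J - {T}))"
  have "p \<in> ?W"
  proof (rule closed_segment_start)
    show "closed ?W" by (intro closed_UN) (simp_all add: closed_root_polytope)
    fix s :: real assume s: "0 < s" "s \<le> 1"
    let ?q = "(1 - s) *\<^sub>R p + s *\<^sub>R edge_vector (e', v')"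
    have "p \<in> root_polytope G"
      using p(1) root_polytope_mono[of "T - {\<epsilon>}" G] jaegerD(2)[OF J] by blast
    then have "?q \<in> root_polytope G"
      using s convexD[OF convex_root_polytope _ edge_vector_in[OF g(1)]] by simp
    then obtain T' where T': "T' \<in> ?J" "?q \<in> root_polytope T'" using jaeger_cover by blast
    have "cut_value ?A p = 0"
      using cut_value_root_polytope_0[OF jaegerD(4)[OF J] evT] p(1) by simp
    \<comment> \<open>The functional falls from \<open>0\<close> to \<open>-1\<close> along the
      segment, so beyond \<open>p\<close> the points lie outside the simplex of
      \<open>T\<close>.\<close>
    then have "cut_value ?A ?q = - s"
      using g by (simp add: linear_add[OF linear_cut_value] linear_scale[OF linear_cut_value]
          cut_value_edge_vector)
    then have "T' \<noteq> T"
      using cut_value_root_polytope_nonneg[OF jaegerD(4)[OF J] evT, of ?q] T'(2) s by auto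
    then show "?q \<in> ?W" using T' by blast
  qed
  then obtain S where S: "S \<in> ?J" "S \<noteq> T" "p \<in> root_polytope S" by blast
  have "\<not> violet_less r b0 \<beta> T S"
  proof
    assume "violet_less r b0 \<beta> T S"
    then obtain \<epsilon>' where \<epsilon>': "\<epsilon>' \<in> S" "b0 \<notin> shore S \<epsilon>'"
      "\<And>\<delta>. \<delta> \<in> T \<Longrightarrow> cut_value (shore S \<epsilon>') (edge_vector \<delta>) \<le> 0"
      using preceding_separated[OF J S(1)] by metis
    let ?B = "shore S \<epsilon>'"
    obtain x where x: "(\<Sum>\<delta>\<in>T - {\<epsilon>}. x \<delta> *\<^sub>R edge_vector \<delta>) = p"
      using p(1) by (auto simp: mem_root_polytope)
    have x_pos: "0 < x \<delta>" if "\<delta> \<in> T - {\<epsilon>}" for \<delta>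
      using coefficient_eq_cut_value[OF jaegerD(4)[OF J], of \<delta> "T - {\<epsilon>}" x, unfolded x] p(2)[OF that] that
      by auto
    \<comment> \<open>The functional of \<open>?B\<close> is nonnegative at \<open>p\<close> but
      nonpositive on the edges of \<open>T\<close>. Since \<open>p\<close> has positive
      coefficients, it must vanish on all edges of \<open>T - {\<epsilon>}\<close>.\<close>
    have nonneg: "\<forall>\<delta>\<in>T - {\<epsilon>}. 0 \<le> x \<delta> * - cut_value ?B (edge_vector \<delta>)"
    proof
      fix \<delta> assume \<delta>: "\<delta> \<in> T - {\<epsilon>}"
      have "0 \<le> x \<delta>" using x_pos[OF \<delta>] by (rule less_imp_le)
      moreover have "0 \<le> - cut_value ?B (edge_vector \<delta>)" using \<epsilon>'(3)[of \<delta>] \<delta> by simp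
      ultimately show "0 \<le> x \<delta> * - cut_value ?B (edge_vector \<delta>)" by (rule mult_nonneg_nonneg)
    qed
    have "0 \<le> cut_value ?B p"
      by (rule cut_value_root_polytope_nonneg[OF jaegerD(4)[OF S(1)] \<epsilon>'(1) S(3)])
    then have "0 \<le> (\<Sum>\<delta>\<in>T - {\<epsilon>}. x \<delta> * cut_value ?B (edge_vector \<delta>))"
      by (simp only: cut_value_sum flip: x)
    then have "(\<Sum>\<delta>\<in>T - {\<epsilon>}. x \<delta> * - cut_value ?B (edge_vector \<delta>)) \<le> 0"
      by (simp add: sum_negf)
    moreover have "0 \<le> (\<Sum>\<delta>\<in>T - {\<epsilon>}. x \<delta> * - cut_value ?B (edge_vector \<delta>))"
      using nonneg by (intro sum_nonneg) blast
    ultimately have "(\<Sum>\<delta>\<in>T - {\<epsilon>}. x \<delta> * - cut_value ?B (edge_vector \<delta>)) = 0" by simp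
    then have zero: "x \<delta> * - cut_value ?B (edge_vector \<delta>) = 0" if "\<delta> \<in> T - {\<epsilon>}" for \<delta>
      using sum_nonneg_eq_0_iff[of "T - {\<epsilon>}" "\<lambda>\<delta>. x \<delta> * - cut_value ?B (edge_vector \<delta>)"] nonneg that
      by simp
    have same: "Inl a \<in> ?B \<longleftrightarrow> Inr b \<in> ?B" if "(a, b) \<in> T - {\<epsilon>}" for a b
      using zero[OF that] x_pos[OF that] by (auto simp: cut_value_edge_vector)
    have out: "component (T - {(e, v)}) y \<subseteq> - ?B" if "y \<notin> ?B" for y
    proof (rule component_subsetI)
      fix z w assume "z \<in> - ?B" "(z, w) \<in> adjacent (T - {(e, v)})"
      then show "w \<in> - ?B" using same by (cases z; cases w) auto
    qed (use that in simp)
    have compl: "component (T - {(e, v)}) (Inr v) = - ?A"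
      by (rule shore_compl[OF jaegerD(3,4)[OF J] evT])
    \<comment> \<open>No edge of \<open>T - {\<epsilon>}\<close> crosses the cut of
      \<open>?B\<close>, and the base node is outside \<open>?B\<close>, so its whole component is.
      The shore of \<epsilon> must then be inside, which makes the functional positive on
      \<epsilon>.\<close>
    then have "component (T - {(e, v)}) b0 = - ?A" using b0 component_eq by blast
    then have sub: "- ?A \<subseteq> - ?B" using out[OF \<epsilon>'(2)] by simp
    then have v: "Inr v \<notin> ?B" using compl component_refl by blast
    have "Inl e \<in> ?B"
    proof (rule ccontr)
      assume "Inl e \<notin> ?B"
      then have "?A \<subseteq> - ?B" using out[of "Inl e"] by (simp add: shore_def)
      then have "?B = {}" using sub by blast
      then show False using Inl_shore[of "fst \<epsilon>'" S "snd \<epsilon>'"] by simp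
    qed
    then show False using \<epsilon>'(3)[OF evT] v by (simp add: cut_value_edge_vector)
  qed
  then have "violet_less r b0 \<beta> S T" using violet_less_total[OF J S(1)] S(2) by blast
  then show ?thesis using S unfolding preceding_def by blast
qed

text \<open>The segment from any point of the facet to its center is interior after its start, and
  the preceding union is closed.\<close>

lemma semi_passive_facet:
  assumes J: "T \<in> V_cut_Jaeger_trees G r b0 \<beta>" and \<epsilon>: "\<epsilon> \<in> semi_passive T"
  shows "root_polytope (T - {\<epsilon>}) \<subseteq> preceding T"
proof
  fix p assume p: "p \<in> root_polytope (T - {\<epsilon>})"
  obtain c where c: "c \<in> root_polytope (T - {\<epsilon>})" "\<And>\<delta>. \<delta> \<in> T - {\<epsilon>} \<Longrightarrow> 0 < cut_value (shore T \<delta>) c"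
    by (rule root_polytope_center[OF jaegerD(4)[OF J] _ semi_passive_Diff_nonempty[OF assms]]) auto
  show "p \<in> preceding T"
  proof (rule closed_segment_start)
    have "preceding T = \<Union>(root_polytope ` {T' \<in> V_cut_Jaeger_trees G r b0 \<beta>. violet_less r b0 \<beta> T' T})"
      by (auto simp: preceding_def)
    moreover have "closed \<dots>" by (intro closed_UN) (simp_all add: closed_root_polytope)
    ultimately show "closed (preceding T)" by simp
    fix s :: real assume s: "0 < s" "s \<le> 1"
    show "(1 - s) *\<^sub>R p + s *\<^sub>R c \<in> preceding T"
    proof (rule semi_passive_facet_interior[OF assms])
      show "(1 - s) *\<^sub>R p + s *\<^sub>R c \<in> root_polytope (T - {\<epsilon>})"
        using s convexD[OF convex_root_polytope p c(1)] by simp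
      fix \<delta> assume \<delta>: "\<delta> \<in> T - {\<epsilon>}"
      have "p \<in> root_polytope T" using p root_polytope_mono[of "T - {\<epsilon>}" T] by blast
      then have "0 \<le> cut_value (shore T \<delta>) p"
        using cut_value_root_polytope_nonneg[OF jaegerD(4)[OF J]] \<delta> by blast
      then show "0 < cut_value (shore T \<delta>) ((1 - s) *\<^sub>R p + s *\<^sub>R c)"
        using s c(2)[OF \<delta>]
        by (simp add: linear_add[OF linear_cut_value] linear_scale[OF linear_cut_value]
            add_nonneg_pos)
    qed
  qed
qed

lemma Int_preceding:
  assumes J: "T \<in> V_cut_Jaeger_trees G r b0 \<beta>"
  shows "root_polytope T \<inter> preceding T = \<Union>((\<lambda>\<epsilon>. root_polytope (T - {\<epsilon>})) ` semi_passive T)"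
  using facet_if_preceding[OF J] semi_passive_facet[OF J] root_polytope_mono[of "T - {\<epsilon>}" T for \<epsilon>]
  by blast

lemma semi_passive_facet_of:
  assumes "T \<in> V_cut_Jaeger_trees G r b0 \<beta>" "\<epsilon> \<in> semi_passive T"
  shows "root_polytope (T - {\<epsilon>}) facet_of root_polytope T"
  using semi_passive_Diff_nonempty[OF assms] assms(2) facet_of_root_polytope[OF jaegerD(4)[OF assms(1)]]
  by (auto simp: semi_passive_def)

text \<open>The center of a facet in the preceding union lies on a semi-passive facet; as only one
  of its coefficients vanishes, the two facets coincide.\<close>

lemma preceding_facets:
  assumes J: "T \<in> V_cut_Jaeger_trees G r b0 \<beta>"
  shows "{F. F facet_of root_polytope T \<and> F \<subseteq> preceding T} =
    (\<lambda>\<epsilon>. root_polytope (T - {\<epsilon>})) ` semi_passive T"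
proof (intro subset_antisym subsetI)
  fix F assume "F \<in> {F. F facet_of root_polytope T \<and> F \<subseteq> preceding T}"
  then obtain \<epsilon> where \<epsilon>: "\<epsilon> \<in> T" "T - {\<epsilon>} \<noteq> {}" "F = root_polytope (T - {\<epsilon>})" "F \<subseteq> preceding T"
    by (auto simp: facet_of_root_polytope[OF jaegerD(4)[OF J]])
  obtain c where c: "c \<in> root_polytope (T - {\<epsilon>})" "\<And>\<delta>. \<delta> \<in> T - {\<epsilon>} \<Longrightarrow> 0 < cut_value (shore T \<delta>) c"
    by (rule root_polytope_center[OF jaegerD(4)[OF J] _ \<epsilon>(2)]) auto
  have "c \<in> root_polytope T" using c(1) root_polytope_mono[of "T - {\<epsilon>}" T] by blast
  then obtain \<delta> where \<delta>: "\<delta> \<in> semi_passive T" "c \<in> root_polytope (T - {\<delta>})"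
    using facet_if_preceding[OF J] c(1) \<epsilon>(3,4) by blast
  have "cut_value (shore T \<delta>) c = 0"
    using cut_value_root_polytope_0[OF jaegerD(4)[OF J] _ \<delta>(2)] \<delta>(1) by (simp add: semi_passive_def)
  then have "\<delta> = \<epsilon>" using c(2)[of \<delta>] \<delta>(1) by (auto simp: semi_passive_def)
  then show "F \<in> (\<lambda>\<epsilon>. root_polytope (T - {\<epsilon>})) ` semi_passive T" using \<delta>(1) \<epsilon>(3) by blast
next
  fix F assume "F \<in> (\<lambda>\<epsilon>. root_polytope (T - {\<epsilon>})) ` semi_passive T"
  then show "F \<in> {F. F facet_of root_polytope T \<and> F \<subseteq> preceding T}"
    using semi_passive_facet[OF J] semi_passive_facet_of[OF J] by blast
qed

lemma card_preceding_facets: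
  assumes J: "T \<in> V_cut_Jaeger_trees G r b0 \<beta>"
  shows "card {F. F facet_of root_polytope T \<and> F \<subseteq> preceding T} = card (semi_passive T)"
proof -
  have "inj_on (\<lambda>\<epsilon>. root_polytope (T - {\<epsilon>})) T"
  proof (rule inj_onI, rule ccontr)
    fix \<epsilon> \<delta> assume *: "\<epsilon> \<in> T" "\<delta> \<in> T" "root_polytope (T - {\<epsilon>}) = root_polytope (T - {\<delta>})" "\<epsilon> \<noteq> \<delta>"
    then have "edge_vector \<delta> \<in> root_polytope (T - {\<delta>})" using edge_vector_in[of \<delta> "T - {\<epsilon>}"] by blast
    then show False
      using cut_value_root_polytope_0[OF jaegerD(4)[OF J] *(2)] cut_value_shore[OF jaegerD(4)[OF J] *(2) *(2)]
      by simp
  qed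
  then have "inj_on (\<lambda>\<epsilon>. root_polytope (T - {\<epsilon>})) (semi_passive T)"
    by (rule inj_on_subset) (auto simp: semi_passive_def)
  then show ?thesis unfolding preceding_facets[OF J] by (rule card_image)
qed

text \<open>Needed to carry the order of the trees over to their simplices. A nonempty relative
  interior misses every preceding simplex, so no simplex occurs twice.\<close>

lemma inj_root_polytope: "inj_on root_polytope (V_cut_Jaeger_trees G r b0 \<beta>)"
proof -
  have ne: "root_polytope T \<noteq> root_polytope T'"
    if J: "T \<in> V_cut_Jaeger_trees G r b0 \<beta>" "T' \<in> V_cut_Jaeger_trees G r b0 \<beta>"
      and less: "violet_less r b0 \<beta> T' T" for T T'
  proof
    assume eq: "root_polytope T = root_polytope T'"
    obtain \<epsilon> where "\<epsilon> \<in> T" using preceding_separated[OF J(2,1) less] by blast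
    then have "root_polytope T \<noteq> {}" using edge_vector_in by blast
    then have "rel_interior (root_polytope T) \<noteq> {}"
      by (simp add: rel_interior_eq_empty convex_root_polytope)
    moreover have "rel_interior (root_polytope T) \<inter> root_polytope T = {}"
      using rel_interior_Int_preceding[OF J less] eq by simp
    ultimately show False using rel_interior_subset[of "root_polytope T"] by blast
  qed
  show ?thesis
  proof (rule inj_onI, rule ccontr)
    fix T T' assume *: "T \<in> V_cut_Jaeger_trees G r b0 \<beta>" "T' \<in> V_cut_Jaeger_trees G r b0 \<beta>"
      "root_polytope T = root_polytope T'" "T \<noteq> T'"
    then show False using violet_less_total[OF *(1,2,4)] ne[of T T'] ne[of T' T] by auto
  qed
qed

section \<open>The dissection and its shelling\<close>

lemma dissection_jaeger: "dissection (root_polytope G) (root_polytope ` V_cut_Jaeger_trees G r b0 \<beta>)"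
  unfolding dissection_def
proof (intro conjI ballI)
  show "finite (root_polytope ` V_cut_Jaeger_trees G r b0 \<beta>)" by simp
  show "aff_dim (root_polytope G) simplex \<sigma>" if "\<sigma> \<in> root_polytope ` V_cut_Jaeger_trees G r b0 \<beta>" for \<sigma>
    using that simplex_root_polytope[OF jaegerD(3,4,2)] by auto
  show "\<Union>(root_polytope ` V_cut_Jaeger_trees G r b0 \<beta>) = root_polytope G"
  proof
    show "\<Union>(root_polytope ` V_cut_Jaeger_trees G r b0 \<beta>) \<subseteq> root_polytope G"
      using root_polytope_mono[OF jaegerD(2)] by blast
    show "root_polytope G \<subseteq> \<Union>(root_polytope ` V_cut_Jaeger_trees G r b0 \<beta>)"
      using jaeger_cover by blast
  qed
  show "pairwise (\<lambda>\<sigma> \<tau>. rel_interior \<sigma> \<inter> rel_interior \<tau> = {}) (root_polytope ` V_cut_Jaeger_trees G r b0 \<beta>)"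
  proof (rule pairwise_imageI)
    fix T T' assume *: "T \<in> V_cut_Jaeger_trees G r b0 \<beta>" "T' \<in> V_cut_Jaeger_trees G r b0 \<beta>" "T \<noteq> T'"
    then show "rel_interior (root_polytope T) \<inter> rel_interior (root_polytope T') = {}"
      using violet_less_total[OF *] rel_interior_Int_preceding[of T T'] rel_interior_Int_preceding[of T' T]
        rel_interior_subset[of "root_polytope T"] rel_interior_subset[of "root_polytope T'"]
      by blast
  qed
qed

lemma shelling_order_jaeger:
  defines "J \<equiv> V_cut_Jaeger_trees G r b0 \<beta>"
  shows "shelling_order (root_polytope G) (root_polytope ` J)
    {(root_polytope T1, root_polytope T2) |T1 T2. T1 \<in> J \<and> T2 \<in> J \<and> violet_less r b0 \<beta> T1 T2}"
    (is "shelling_order _ _ ?R")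
  unfolding shelling_order_def
proof (intro conjI)
  have inj: "root_polytope T = root_polytope T' \<Longrightarrow> T \<in> J \<Longrightarrow> T' \<in> J \<Longrightarrow> T = T'" for T T'
    using inj_onD[OF inj_root_polytope] by (simp add: J_def)
  have R: "(root_polytope T1, root_polytope T2) \<in> ?R \<longleftrightarrow> violet_less r b0 \<beta> T1 T2"
    if "T1 \<in> J" "T2 \<in> J" for T1 T2
    using that inj by blast
  show "dissection (root_polytope G) (root_polytope ` J)" unfolding J_def by (rule dissection_jaeger)
  show "?R \<subseteq> root_polytope ` J \<times> root_polytope ` J" by blast
  show "strict_linear_order_on (root_polytope ` J) ?R"
    unfolding strict_linear_order_on_def
  proof (intro conjI)
    have vl_trans: "violet_less r b0 \<beta> T1 T3" if "violet_less r b0 \<beta> T1 T2" "violet_less r b0 \<beta> T2 T3"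
      "T1 \<in> J" "T2 \<in> J" "T3 \<in> J" for T1 T2 T3
      using that transD[OF trans_lex_less] unfolding J_def by (simp add: violet_less_lex)
    have trans: "(root_polytope T1, root_polytope T3) \<in> ?R"
      if "violet_less r b0 \<beta> T1 T2" "violet_less r b0 \<beta> T2 T3" "T1 \<in> J" "T2 \<in> J" "T3 \<in> J" for T1 T2 T3
      using that R[of T1 T3] vl_trans[of T1 T2 T3] by simp
    show "trans ?R"
    proof (rule transI)
      fix \<sigma> \<tau> \<rho> assume "(\<sigma>, \<tau>) \<in> ?R" "(\<tau>, \<rho>) \<in> ?R"
      then obtain T1 T2 T2' T3 where T: "T1 \<in> J" "T2 \<in> J" "T2' \<in> J" "T3 \<in> J"
        "violet_less r b0 \<beta> T1 T2" "violet_less r b0 \<beta> T2' T3" "\<tau> = root_polytope T2" "\<tau> = root_polytope T2'"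
        and eq: "\<sigma> = root_polytope T1" "\<rho> = root_polytope T3"
        by blast
      \<comment> \<open>The middle simplex comes from two a priori different trees.\<close>
      then have "T2' = T2" using inj[of T2' T2] by simp
      then show "(\<sigma>, \<rho>) \<in> ?R" unfolding eq using T by (intro trans[of T1 T2 T3]) simp_all
    qed
    show "irrefl ?R" using inj by (intro irreflI) (auto simp: violet_less_def)
    show "total_on (root_polytope ` J) ?R"
    proof (rule total_onI)
      fix \<sigma> \<tau> assume *: "\<sigma> \<in> root_polytope ` J" "\<tau> \<in> root_polytope ` J" "\<sigma> \<noteq> \<tau>"
      then obtain T T' where T: "T \<in> J" "T' \<in> J" "T \<noteq> T'" "\<sigma> = root_polytope T" "\<tau> = root_polytope T'"
        by blast
      then show "(\<sigma>, \<tau>) \<in> ?R \<or> (\<tau>, \<sigma>) \<in> ?R"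
        using violet_less_total[of T T'] R[of T T'] R[of T' T] unfolding J_def by blast
    qed
  qed
  show "\<forall>\<sigma>\<in>root_polytope ` J. (\<exists>\<tau>. (\<tau>, \<sigma>) \<in> ?R) \<longrightarrow>
      (\<exists>\<F>. \<F> \<noteq> {} \<and> (\<forall>F\<in>\<F>. F facet_of \<sigma>) \<and> \<sigma> \<inter> \<Union>{\<tau>. (\<tau>, \<sigma>) \<in> ?R} = \<Union>\<F>)"
  proof (intro ballI impI)
    fix \<sigma> assume "\<sigma> \<in> root_polytope ` J" "\<exists>\<tau>. (\<tau>, \<sigma>) \<in> ?R"
    then obtain T T' where T: "T \<in> J" "\<sigma> = root_polytope T" "T' \<in> J" "violet_less r b0 \<beta> T' T"
      using inj by blast
    have "{\<tau>. (\<tau>, \<sigma>) \<in> ?R} = {root_polytope T' |T'. T' \<in> J \<and> violet_less r b0 \<beta> T' T}"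
      using T(1,2) inj by blast
    then have "\<Union>{\<tau>. (\<tau>, \<sigma>) \<in> ?R} = preceding T" by (simp add: preceding_def J_def)
    moreover have "semi_passive T \<noteq> {}"
    proof -
      obtain \<epsilon> where "\<epsilon> \<in> T" "internally_semi_passive G (emerald_less r b0 \<beta> T) T \<epsilon>"
        using preceding_separated[of T' T] T unfolding J_def by metis
      then have "\<epsilon> \<in> semi_passive T" by (simp add: semi_passive_def)
      then show ?thesis by blast
    qed
    ultimately show "\<exists>\<F>. \<F> \<noteq> {} \<and> (\<forall>F\<in>\<F>. F facet_of \<sigma>) \<and> \<sigma> \<inter> \<Union>{\<tau>. (\<tau>, \<sigma>) \<in> ?R} = \<Union>\<F>"
      using Int_preceding[of T] semi_passive_facet_of[of T] T(1,2) unfolding J_def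
      by (intro exI[of _ "(\<lambda>\<epsilon>. root_polytope (T - {\<epsilon>})) ` semi_passive T"]) simp
  qed
qed

end

theorem theorem7p8:
  fixes G :: "('e::finite \<times> 'v::finite) set"
    and r :: "('e, 'v) ribbon"
    and b0 :: "('e, 'v) node"
    and b0b1 :: "('e, 'v) edge"
  assumes "connected_graph G"
    and "ribbon_structure G r"
    and "b0b1 \<in> incident_edges G b0"
  defines "\<J> \<equiv> V_cut_Jaeger_trees G r b0 b0b1"
  shows "shelling_order (root_polytope G) (root_polytope ` \<J>)
        {(root_polytope T1, root_polytope T2) |T1 T2.
           T1 \<in> \<J> \<and> T2 \<in> \<J> \<and> violet_less r b0 b0b1 T1 T2} \<and>
      (\<forall>T\<in>\<J>.
        card {F. F facet_of root_polytope T \<and>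
                 F \<subseteq> \<Union>{root_polytope T' |T'. T' \<in> \<J> \<and> violet_less r b0 b0b1 T' T}} =
        card {\<epsilon> \<in> T. internally_semi_passive G (emerald_less r b0 b0b1 T) T \<epsilon>})"
proof -
  interpret ribbon_graph G r b0 b0b1 by unfold_locales (use assms(1-3) in simp_all)
  show ?thesis
    unfolding \<J>_def
    using shelling_order_jaeger card_preceding_facets[unfolded preceding_def semi_passive_def] by blast
qed

end
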